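(* Let $X$, $Y$ be Banach spaces. Then the following hold: (a) $n(\mathcal{L}_{w^*}(X^*,Y))\leq \min\{n(X),n(Y)\}$. (b) $n(\mathcal{K}_{w^*}(X^*,Y))\leq \min\{n(X),n(Y)\}$. (c) $n(\mathcal{W}(X,Y))\leq \min\{n(X^* ),n(Y)\}$. (d) $n(\mathcal{K}(X,Y))\leq \min\{n(X^* ),n(Y)\}$.
   Context: Banach spaces are (nonzero) real or complex; $X$ and $Y$ are over the same field. $S_X$ denotes the unit sphere of $X$, $X^*$ its topological dual, and $\mathcal{L}(X)$ the Banach space of bounded linear operators on $X$ with the operator norm. For $T\in\mathcal{L}(X)$ the numerical radius is $v(T)=\sup\{|x^*(Tx)| : x\in S_X,\ x^*\in S_{X^*},\ x^*(x)=1\}$. The numerical index of $X$ is $n(X)=\inf\{v(T): T\in\mathcal{L}(X),\ \|T\|=1\}$. $\mathcal{K}(X,Y)$ and $\mathcal{W}(X,Y)$ are the spaces of compact, respectively weakly compact, operators from $X$ to $Y$. $\mathcal{L}_{w^*}(X^*,Y)$ is the space of bounded linear operators from $X^*$ into $Y$ that are weak$^*$-to-weak continuous, and $\mathcal{K}_{w^*}(X^*,Y)$ is the space of compact operators from $X^*$ into $Y$ that are weak$^*$-to-weak continuous. All these spaces are endowed with the operator norm. *)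

theory Defs
  imports "HOL-Analysis.Analysis" "HOL-Library.Function_Algebras"
begin

text \<open>
  The real and complex cases are treated together: the class below consists of the normed fields
  that are isometrically isomorphic, as fields, to the reals or to the complex numbers.
\<close>

class real_or_complex = real_normed_field +
  assumes real_or_complex:
    "(\<exists>h :: 'a \<Rightarrow> real. bij h \<and> (\<forall>a b. h (a + b) = h a + h b) \<and>
        (\<forall>a b. h (a * b) = h a * h b) \<and> (\<forall>a. \<bar>h a\<bar> = norm a)) \<or>
     (\<exists>h :: 'a \<Rightarrow> complex. bij h \<and> (\<forall>a b. h (a + b) = h a + h b) \<and>
        (\<forall>a b. h (a * b) = h a * h b) \<and> (\<forall>a. cmod (h a) = norm a))"

instance real :: real_or_complex
  by standard (intro disjI1 exI[of _ "\<lambda>x. x"], auto simp: bij_id[unfolded id_def])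

instance complex :: real_or_complex
  by standard (intro disjI2 exI[of _ "\<lambda>x. x"], auto simp: bij_id[unfolded id_def])

text \<open>
  The underlying set of a space is a linear subspace of a vector space whose elements form the
  type \<open>'v\<close>; the norm matters on this subspace only. Explicit carriers are needed because the
  dual and the spaces of operators depend on the scalar multiplications of the given spaces.
\<close>

record ('k, 'v) nspace =
  carrier :: "'v set"
  scl :: "'k \<Rightarrow> 'v \<Rightarrow> 'v"
  nrm :: "'v \<Rightarrow> real"

text \<open>
  \<^locale>\<open>Metric_space\<close> requires nonnegativity and symmetry also for points outside its underlying set.
\<close>

definition norm_dist :: "('k, 'v::ab_group_add) nspace \<Rightarrow> 'v \<Rightarrow> 'v \<Rightarrow> real" where
  "norm_dist X x y = (if x \<in> carrier X \<and> y \<in> carrier X then nrm X (x - y) else 0)"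

locale banach_space =
  fixes X :: "('k::real_or_complex, 'v::ab_group_add) nspace"
  assumes vector_space: "vector_space (scl X)"
    and subspace: "module.subspace (scl X) (carrier X)"
    and nonzero: "\<exists>x\<in>carrier X. x \<noteq> 0"
    and nrm_eq_0: "x \<in> carrier X \<Longrightarrow> nrm X x = 0 \<longleftrightarrow> x = 0"
    and nrm_triangle: "x \<in> carrier X \<Longrightarrow> y \<in> carrier X \<Longrightarrow> nrm X (x + y) \<le> nrm X x + nrm X y"
    and nrm_scl: "x \<in> carrier X \<Longrightarrow> nrm X (scl X c x) = norm c * nrm X x"
    and complete: "Metric_space.mcomplete (carrier X) (norm_dist X)"

lemma banach_space_UNIV:
  fixes s :: "'k::real_or_complex \<Rightarrow> 'v::banach \<Rightarrow> 'v"
  assumes vs: "vector_space s"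
    and norm_s: "\<And>c x. norm (s c x) = norm c * norm x"
    and nz: "\<exists>x::'v. x \<noteq> 0"
  shows "banach_space \<lparr>carrier = UNIV, scl = s, nrm = norm\<rparr>"
proof -
  interpret vector_space s by (fact vs)
  have d: "norm_dist \<lparr>carrier = UNIV, scl = s, nrm = norm\<rparr> = (dist :: 'v \<Rightarrow> 'v \<Rightarrow> real)"
    by (intro ext) (simp add: norm_dist_def dist_norm)
  have "Metric_space.mcomplete UNIV (dist :: 'v \<Rightarrow> 'v \<Rightarrow> real)"
    by (simp add: complete_UNIV)
  then show ?thesis
    by unfold_locales (use nz norm_s in \<open>auto simp: d norm_triangle_ineq vector_space_assms\<close>)
qed

definition unit_ball :: "('k, 'v) nspace \<Rightarrow> 'v set" where
  "unit_ball X = {x \<in> carrier X. nrm X x \<le> 1}"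

definition unit_sphere :: "('k, 'v) nspace \<Rightarrow> 'v set" where
  "unit_sphere X = {x \<in> carrier X. nrm X x = 1}"

definition scalar_space :: "('k::real_or_complex, 'k) nspace" where
  "scalar_space = \<lparr>carrier = UNIV, scl = (*), nrm = norm\<rparr>"

text \<open>
  Operators are extended by zero outside the carrier, so that an operator is determined by its
  values on the carrier and the pointwise operations are those of the space of operators.
\<close>

definition bounded_op ::
  "('k::real_or_complex, 'v::ab_group_add) nspace \<Rightarrow> ('k, 'w::ab_group_add) nspace \<Rightarrow> ('v \<Rightarrow> 'w) \<Rightarrow> bool" where
  "bounded_op X Y T \<longleftrightarrow>
     (\<forall>x\<in>carrier X. T x \<in> carrier Y) \<and>
     (\<forall>x\<in>carrier X. \<forall>y\<in>carrier X. T (x + y) = T x + T y) \<and>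
     (\<forall>c. \<forall>x\<in>carrier X. T (scl X c x) = scl Y c (T x)) \<and>
     (\<exists>C. \<forall>x\<in>carrier X. nrm Y (T x) \<le> C * nrm X x) \<and>
     (\<forall>x. x \<notin> carrier X \<longrightarrow> T x = 0)"

definition op_space ::
  "('k::real_or_complex, 'v::ab_group_add) nspace \<Rightarrow> ('k, 'w::ab_group_add) nspace \<Rightarrow> ('k, 'v \<Rightarrow> 'w) nspace" where
  "op_space X Y =
     \<lparr>carrier = {T. bounded_op X Y T},
      scl = (\<lambda>c T x. scl Y c (T x)),
      nrm = (\<lambda>T. SUP x\<in>unit_ball X. nrm Y (T x))\<rparr>"

definition dual :: "('k::real_or_complex, 'v::ab_group_add) nspace \<Rightarrow> ('k, 'v \<Rightarrow> 'k) nspace" where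
  "dual X = op_space X scalar_space"

definition numerical_radius ::
  "('k::real_or_complex, 'v::ab_group_add) nspace \<Rightarrow> ('v \<Rightarrow> 'v) \<Rightarrow> real" where
  "numerical_radius X T =
     Sup {norm (f (T x)) | x f. x \<in> unit_sphere X \<and> f \<in> unit_sphere (dual X) \<and> f x = 1}"

definition numerical_index :: "('k::real_or_complex, 'v::ab_group_add) nspace \<Rightarrow> real" where
  "numerical_index X = (INF T\<in>unit_sphere (op_space X X). numerical_radius X T)"

definition norm_topology :: "('k, 'v::ab_group_add) nspace \<Rightarrow> 'v topology" where
  "norm_topology X = Metric_space.mtopology (carrier X) (norm_dist X)"

definition weak_topology :: "('k::real_or_complex, 'v::ab_group_add) nspace \<Rightarrow> 'v topology" where
  "weak_topology X = topology_generated_by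
     {{x \<in> carrier X. f x \<in> U} | f U. f \<in> carrier (dual X) \<and> open U}"

definition weak_star_topology ::
  "('k::real_or_complex, 'v::ab_group_add) nspace \<Rightarrow> ('v \<Rightarrow> 'k) topology" where
  "weak_star_topology X = topology_generated_by
     {{f \<in> carrier (dual X). f x \<in> U} | x U. x \<in> carrier X \<and> open U}"

definition compact_op ::
  "('k::real_or_complex, 'v::ab_group_add) nspace \<Rightarrow> ('k, 'w::ab_group_add) nspace \<Rightarrow> ('v \<Rightarrow> 'w) \<Rightarrow> bool" where
  "compact_op X Y T \<longleftrightarrow> bounded_op X Y T \<and>
     compactin (norm_topology Y) (norm_topology Y closure_of (T ` unit_ball X))"

definition weakly_compact_op ::
  "('k::real_or_complex, 'v::ab_group_add) nspace \<Rightarrow> ('k, 'w::ab_group_add) nspace \<Rightarrow> ('v \<Rightarrow> 'w) \<Rightarrow> bool" where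
  "weakly_compact_op X Y T \<longleftrightarrow> bounded_op X Y T \<and>
     compactin (weak_topology Y) (weak_topology Y closure_of (T ` unit_ball X))"

definition compact_op_space ::
  "('k::real_or_complex, 'v::ab_group_add) nspace \<Rightarrow> ('k, 'w::ab_group_add) nspace \<Rightarrow> ('k, 'v \<Rightarrow> 'w) nspace" where
  "compact_op_space X Y = (op_space X Y)\<lparr>carrier := {T. compact_op X Y T}\<rparr>"

definition weakly_compact_op_space ::
  "('k::real_or_complex, 'v::ab_group_add) nspace \<Rightarrow> ('k, 'w::ab_group_add) nspace \<Rightarrow> ('k, 'v \<Rightarrow> 'w) nspace" where
  "weakly_compact_op_space X Y = (op_space X Y)\<lparr>carrier := {T. weakly_compact_op X Y T}\<rparr>"

text \<open>
  The spaces \<open>\<L>\<^sub>w\<^sub>*(X\<^sup>*, Y)\<close> and \<open>\<K>\<^sub>w\<^sub>*(X\<^sup>*, Y)\<close>; their elements are defined on the dual of the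
  first argument.
\<close>

definition weak_star_op_space ::
  "('k::real_or_complex, 'v::ab_group_add) nspace \<Rightarrow> ('k, 'w::ab_group_add) nspace \<Rightarrow> ('k, ('v \<Rightarrow> 'k) \<Rightarrow> 'w) nspace" where
  "weak_star_op_space X Y = (op_space (dual X) Y)\<lparr>carrier :=
     {T. bounded_op (dual X) Y T \<and> continuous_map (weak_star_topology X) (weak_topology Y) T}\<rparr>"

definition weak_star_compact_op_space ::
  "('k::real_or_complex, 'v::ab_group_add) nspace \<Rightarrow> ('k, 'w::ab_group_add) nspace \<Rightarrow> ('k, ('v \<Rightarrow> 'k) \<Rightarrow> 'w) nspace" where
  "weak_star_compact_op_space X Y = (op_space (dual X) Y)\<lparr>carrier :=
     {T. compact_op (dual X) Y T \<and> continuous_map (weak_star_topology X) (weak_topology Y) T}\<rparr>"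

end

theory Submission
  imports Defs
begin

text \<open>
  Each of the four spaces of operators, call it \<open>Z\<close>, is compared with a space \<open>A\<close> (which is \<open>X\<close>,
  the dual of \<open>X\<close>, or \<open>Y\<close>) by sending an operator \<open>S\<close> of norm one on \<open>A\<close> to an operator \<open>P\<close> on \<open>Z\<close>
  with \<open>\<parallel>P\<parallel> = 1\<close> and \<open>v(P) \<le> v(S)\<close>. Then \<open>n(Z) \<le> v(P) \<le> v(S)\<close> for every \<open>S\<close>, which gives
  \<open>n(Z) \<le> n(A)\<close>.

  The numerical radius is compared through norms. On the one hand, a state \<open>F\<close> of \<open>Z\<close> at \<open>z\<close> satisfies
  \<open>1 + a \<bar>F (P z)\<bar> \<le> \<parallel>z + c P z\<parallel>\<close> for a suitable scalar \<open>c\<close> of modulus \<open>a\<close>. On the other hand,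
  Lumer's estimate \<open>\<parallel>I + c S\<parallel> \<le> (1 + a\<^sup>2 \<parallel>S\<parallel>\<^sup>2) / (1 - a v(S))\<close> (lemma \<open>identity_perturbation_le\<close>)
  bounds the growth of \<open>\<parallel>I + c S\<parallel>\<close> by the numerical radius. If \<open>P\<close> satisfies
  \<open>\<parallel>d I + c P\<parallel> \<le> \<parallel>d I + c S\<parallel>\<close> for all scalars, then letting \<open>a\<close> tend to \<open>0\<close> gives \<open>v(P) \<le> v(S)\<close>; this is
  \<open>numerical_index_le_if_pencil_dominated\<close>. That \<open>P\<close> has norm at least \<open>1\<close> is seen on rank-one
  operators.

  For \<open>A = Y\<close> the operator \<open>P\<close> is \<open>T \<mapsto> S \<circ> T\<close>. For operators on the dual of \<open>X\<close> and \<open>A = X\<close> it is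
  \<open>T \<mapsto> T \<circ> S\<^sup>*\<close>, and weak-star continuity survives because \<open>S\<^sup>*\<close> is weak-star continuous. For compact or
  weakly compact operators on \<open>X\<close> and \<open>A = X\<^sup>*\<close> it is \<open>T \<mapsto> T\<^sup>*\<^sup>* \<circ> S\<^sup>* \<circ> J\<close> with the embedding \<open>J\<close> of \<open>X\<close>
  in its bidual. Here \<open>T\<^sup>*\<^sup>*\<close> maps the ball of the bidual into the closure of the image of the ball
  of \<open>X\<close> under \<open>T\<close> (\<open>second_adjoint_value\<close>), as follows from Goldstine's theorem and compactness. So
  the new operator takes values in \<open>Y\<close> and is compact in the same sense as \<open>T\<close>.

  The tools from functional analysis (a norming functional for each vector, Goldstine's theorem) are
  proved for both scalar fields at once.
\<close>

section \<open>Scalars\<close>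

lemma complex_embedding_exists:
  "\<exists>h :: 'k::real_or_complex \<Rightarrow> complex. (\<forall>a b. h (a + b) = h a + h b) \<and>
     (\<forall>a b. h (a * b) = h a * h b) \<and> (\<forall>a. cmod (h a) = norm a) \<and>
     (range h = range complex_of_real \<or> range h = UNIV)"
  using real_or_complex[where 'a='k]
proof (elim disjE exE conjE)
  fix h :: "'k \<Rightarrow> real"
  assume h: "bij h" "\<forall>a b. h (a + b) = h a + h b" "\<forall>a b. h (a * b) = h a * h b"
    "\<forall>a. \<bar>h a\<bar> = norm a"
  then show ?thesis
    by (intro exI[of _ "\<lambda>a. complex_of_real (h a)"])
      (auto simp: image_image[symmetric, of complex_of_real h] bij_is_surj)
next
  fix h :: "'k \<Rightarrow> complex"
  assume "bij h" "\<forall>a b. h (a + b) = h a + h b" "\<forall>a b. h (a * b) = h a * h b"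
    "\<forall>a. cmod (h a) = norm a"
  then show ?thesis by (intro exI[of _ h]) (auto simp: bij_is_surj)
qed

text \<open>
  A common copy of the real and the complex case inside the complex numbers, where real parts and
  conjugates are available. The condition on the range tells the two cases apart.
\<close>

definition to_complex :: "'k::real_or_complex \<Rightarrow> complex" where
  "to_complex = (SOME h. (\<forall>a b. h (a + b) = h a + h b) \<and>
     (\<forall>a b. h (a * b) = h a * h b) \<and> (\<forall>a. cmod (h a) = norm a) \<and>
     (range h = range complex_of_real \<or> range h = UNIV))"

lemma to_complex_props:
  "(\<forall>a b :: 'k. to_complex (a + b) = to_complex a + to_complex b) \<and>
   (\<forall>a b :: 'k. to_complex (a * b) = to_complex a * to_complex b) \<and>
   (\<forall>a :: 'k. cmod (to_complex a) = norm a) \<and>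
   (range (to_complex :: 'k::real_or_complex \<Rightarrow> complex) = range complex_of_real \<or>
    range (to_complex :: 'k \<Rightarrow> complex) = UNIV)"
  unfolding to_complex_def by (rule someI_ex[OF complex_embedding_exists])

lemma to_complex_add: "to_complex (a + b) = to_complex a + to_complex b"
  by (simp add: to_complex_props)

lemma to_complex_mult: "to_complex (a * b) = to_complex a * to_complex b"
  by (simp add: to_complex_props)

lemma cmod_to_complex: "cmod (to_complex a) = norm a"
  by (simp add: to_complex_props)

lemma range_to_complex:
  "range (to_complex :: 'k::real_or_complex \<Rightarrow> complex) = range complex_of_real \<or>
   range (to_complex :: 'k \<Rightarrow> complex) = UNIV"
  by (simp only: to_complex_props)

lemma to_complex_0: "to_complex 0 = 0"
  using cmod_to_complex[of 0] by simp

lemma to_complex_minus: "to_complex (- a) = - to_complex a"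
  using to_complex_add[of a "-a"] by (simp add: to_complex_0 eq_neg_iff_add_eq_0 add.commute)

lemma to_complex_diff: "to_complex (a - b) = to_complex a - to_complex b"
  using to_complex_add[of a "-b"] by (simp add: to_complex_minus)

lemma to_complex_eq_iff: "to_complex a = to_complex b \<longleftrightarrow> a = b"
  by (metis cmod_to_complex norm_eq_zero right_minus_eq to_complex_diff)

lemma to_complex_1: "to_complex 1 = 1"
  using to_complex_mult[of 1 "1 :: 'a"] to_complex_eq_iff[of 1 "0 :: 'a"] by (simp add: to_complex_0)

text \<open>
  A complex number \<open>z\<close> with \<open>\<bar>z\<bar> = \<bar>r\<bar>\<close> and \<open>\<bar>z - 1\<bar> = \<bar>r - 1\<bar>\<close> for a real \<open>r\<close> equals \<open>r\<close>;
  so an isometric field homomorphism is automatically the identity on the reals.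
\<close>

lemma to_complex_of_real: "to_complex (of_real r) = complex_of_real r"
proof -
  define z where "z = to_complex (of_real r :: 'a)"
  have "cmod z = \<bar>r\<bar>" by (simp add: z_def cmod_to_complex)
  then have "(cmod z)\<^sup>2 = r\<^sup>2" by simp
  then have 1: "(Re z)\<^sup>2 + (Im z)\<^sup>2 = r\<^sup>2" by (simp only: cmod_power2)
  have "cmod (z - 1) = norm (of_real r - 1 :: 'a)"
    using cmod_to_complex[of "of_real r - 1 :: 'a"] by (simp add: z_def to_complex_1 to_complex_diff)
  also have "\<dots> = \<bar>r - 1\<bar>" using norm_of_real[of "r - 1", where 'a='a] by simp
  finally have "(cmod (z - 1))\<^sup>2 = (r - 1)\<^sup>2" by simp
  then have 2: "(Re z - 1)\<^sup>2 + (Im z)\<^sup>2 = (r - 1)\<^sup>2" by (simp only: cmod_power2) simp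
  from 1 2 have "Re z = r" by (simp add: power2_eq_square algebra_simps)
  with 1 have "Im z = 0" by simp
  with \<open>Re z = r\<close> show ?thesis by (simp add: z_def[symmetric] complex_eq_iff)
qed

definition re :: "'k::real_or_complex \<Rightarrow> real" where "re a = Re (to_complex a)"

lemma re_of_real [simp]: "re (of_real r) = r"
  by (simp add: re_def to_complex_of_real)

lemma re_diff: "re (a - b) = re a - re b"
  by (simp add: re_def to_complex_diff)

lemma re_le_norm: "re a \<le> norm a"
  using complex_Re_le_cmod[of "to_complex a"] by (simp add: re_def cmod_to_complex)

lemma re_sum: "re (sum f I) = (\<Sum>i\<in>I. re (f i))"
  by (induction I rule: infinite_finite_induct) (auto simp: re_def to_complex_add to_complex_0)

lemma eq_of_real_if_re_eq_norm:
  assumes "re a = r" "norm a \<le> r"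
  shows "a = of_real r"
proof -
  have "0 \<le> r" using assms(2) norm_ge_zero order_trans by blast
  have "(Re (to_complex a))\<^sup>2 + (Im (to_complex a))\<^sup>2 \<le> r\<^sup>2"
    using assms(2) by (simp only: cmod_power2[symmetric] cmod_to_complex) (simp add: power_mono)
  with assms(1) have "to_complex a = of_real r" by (simp add: complex_eq_iff re_def)
  then show ?thesis using to_complex_of_real to_complex_eq_iff by metis
qed

lemma conjugate_exists: "\<exists>b :: 'k. to_complex b = cnj (to_complex (a :: 'k::real_or_complex))"
  using range_to_complex[where 'k='k]
proof
  assume "range (to_complex :: 'k \<Rightarrow> complex) = range complex_of_real"
  then obtain r where "to_complex a = complex_of_real r" by blast
  then have "to_complex a = cnj (to_complex a)" by (simp only: complex_cnj_complex_of_real)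
  then show ?thesis by blast
qed (metis surjD)

lemma unimodular_multiplier:
  fixes a :: "'k::real_or_complex"
  obtains c where "norm c = 1" "c * a = of_real (norm a)"
proof (cases "a = 0")
  case False
  then show ?thesis by (intro that[of "of_real (norm a) / a"]) (auto simp: norm_divide)
qed (auto intro: that[of 1])

lemma compact_scalar_cball: "compact (cball 0 1 :: 'k::real_or_complex set)"
proof -
  let ?h = "to_complex :: 'k \<Rightarrow> complex"
  have inj: "inj ?h" by (simp add: inj_def to_complex_eq_iff)
  have "closed (range ?h)"
    using range_to_complex[where 'k='k] closed_complex_Reals by (auto simp: Reals_def)
  then have "compact (cball 0 1 \<inter> range ?h)" by (simp add: compact_Int_closed)
  moreover have "continuous_on (cball 0 1 \<inter> range ?h) (inv ?h)"
  proof -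
    have "dist (inv ?h z) (inv ?h w) = dist z w" if "z \<in> range ?h" "w \<in> range ?h" for z w
      using that by (auto simp: inv_f_f[OF inj] dist_norm to_complex_diff[symmetric] cmod_to_complex)
    then show ?thesis unfolding continuous_on_iff by (metis IntE)
  qed
  moreover have "inv ?h ` (cball 0 1 \<inter> range ?h) = cball 0 1"
  proof
    show "cball 0 1 \<subseteq> inv ?h ` (cball 0 1 \<inter> range ?h)"
    proof
      fix a :: 'k assume "a \<in> cball 0 1"
      then have "a = inv ?h (?h a)" "?h a \<in> cball 0 1 \<inter> range ?h"
        by (auto simp: inv_f_f[OF inj] cmod_to_complex)
      then show "a \<in> inv ?h ` (cball 0 1 \<inter> range ?h)" by blast
    qed
  qed (auto simp: inv_f_f[OF inj] cmod_to_complex)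
  ultimately show ?thesis using compact_continuous_image by metis
qed

section \<open>Linear functionals dominated by a sublinear functional\<close>

definition sublinear_on :: "(real \<Rightarrow> 'v::ab_group_add \<Rightarrow> 'v) \<Rightarrow> 'v set \<Rightarrow> ('v \<Rightarrow> real) \<Rightarrow> bool" where
  "sublinear_on s S p \<longleftrightarrow> (\<forall>x\<in>S. \<forall>y\<in>S. p (x + y) \<le> p x + p y) \<and>
     (\<forall>x\<in>S. \<forall>r\<ge>0. p (s r x) \<le> r * p x)"

text \<open>
  A sublinear functional below \<open>p\<close>, obtained by lowering \<open>p\<close> as far as possible along the ray
  through \<open>x0\<close>. Its value at \<open>- x0\<close> is at most \<open>- p x0\<close>, so a linear functional below it is at least
  \<open>p x0\<close> at \<open>x0\<close>.
\<close>

definition tilt :: "(real \<Rightarrow> 'v::ab_group_add \<Rightarrow> 'v) \<Rightarrow> 'v \<Rightarrow> ('v \<Rightarrow> real) \<Rightarrow> 'v \<Rightarrow> real" where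
  "tilt s x0 p x = (INF t\<in>{0..}. p (x + s t x0) - t * p x0)"

locale real_subspace = vector_space s for s :: "real \<Rightarrow> 'v::ab_group_add \<Rightarrow> 'v" +
  fixes S assumes S: "subspace S"
begin

lemma S_mem [simp]: "0 \<in> S" "x \<in> S \<Longrightarrow> y \<in> S \<Longrightarrow> x + y \<in> S" "x \<in> S \<Longrightarrow> s r x \<in> S"
  "x \<in> S \<Longrightarrow> - x \<in> S"
  using S by (auto simp: subspace_0 subspace_add subspace_scale subspace_neg)

lemma sublinear_add: "sublinear_on s S p \<Longrightarrow> x \<in> S \<Longrightarrow> y \<in> S \<Longrightarrow> p (x + y) \<le> p x + p y"
  by (simp add: sublinear_on_def)

lemma sublinear_scale: "sublinear_on s S p \<Longrightarrow> x \<in> S \<Longrightarrow> 0 \<le> r \<Longrightarrow> p (s r x) \<le> r * p x"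
  by (simp add: sublinear_on_def)

lemma sublinear_0: "sublinear_on s S p \<Longrightarrow> p 0 = 0"
  using sublinear_add[of p 0 0] sublinear_scale[of p 0 0] by simp

lemma sublinear_neg: "sublinear_on s S p \<Longrightarrow> x \<in> S \<Longrightarrow> - p (- x) \<le> p x"
  using sublinear_add[of p x "-x"] sublinear_0[of p] by simp

context
  fixes p x0 assumes p: "sublinear_on s S p" and x0: "x0 \<in> S"
begin

lemma tilt_le: "x \<in> S \<Longrightarrow> 0 \<le> t \<Longrightarrow> tilt s x0 p x \<le> p (x + s t x0) - t * p x0"
  unfolding tilt_def
proof (rule cINF_lower)
  assume x: "x \<in> S"
  have "- p (- x) \<le> p (x + s t x0) - t * p x0" if "0 \<le> t" for t
  proof (cases "t = 0")
    case True
    then show ?thesis using sublinear_neg[OF p x] by simp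
  next
    case False
    have "p x0 = p (s (1 / t) (s t x0))" using False by simp
    also have "\<dots> \<le> (1 / t) * p (s t x0)" by (rule sublinear_scale[OF p]) (use x0 that in auto)
    finally have "t * p x0 \<le> p (s t x0)" using that False by (simp add: field_simps)
    moreover have "p ((x + s t x0) + - x) \<le> p (x + s t x0) + p (- x)"
      by (rule sublinear_add[OF p]) (use x x0 in auto)
    ultimately show ?thesis by simp
  qed
  then show "bdd_below ((\<lambda>t. p (x + s t x0) - t * p x0) ` {0..})"
    by (auto intro!: bdd_belowI2)
qed auto

lemma tilt_greatest: "(\<And>t. 0 \<le> t \<Longrightarrow> l \<le> p (x + s t x0) - t * p x0) \<Longrightarrow> l \<le> tilt s x0 p x"
  unfolding tilt_def by (rule cINF_greatest) auto

lemma tilt_le_self: "x \<in> S \<Longrightarrow> tilt s x0 p x \<le> p x"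
  using tilt_le[of x 0] by simp

lemma tilt_neg: "tilt s x0 p (- x0) \<le> - p x0"
  using tilt_le[of "- x0" 1] x0 sublinear_0[OF p] by simp

lemma sublinear_tilt: "sublinear_on s S (tilt s x0 p)"
  unfolding sublinear_on_def
proof (intro conjI ballI allI impI)
  fix x y assume xy: "x \<in> S" "y \<in> S"
  have step: "tilt s x0 p (x + y) \<le> (p (x + s t x0) - t * p x0) + (p (y + s u x0) - u * p x0)"
    if "0 \<le> t" "0 \<le> u" for t u
  proof -
    have "tilt s x0 p (x + y) \<le> p ((x + s t x0) + (y + s u x0)) - (t + u) * p x0"
      using tilt_le[of "x + y" "t + u"] xy that by (simp add: scale_left_distrib algebra_simps)
    also have "\<dots> \<le> p (x + s t x0) + p (y + s u x0) - (t + u) * p x0"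
      using sublinear_add[OF p] xy x0 by simp
    finally show ?thesis by (simp add: algebra_simps)
  qed
  have "tilt s x0 p (x + y) - (p (x + s t x0) - t * p x0) \<le> tilt s x0 p y" if "0 \<le> t" for t
  proof (rule tilt_greatest)
    fix u :: real assume "0 \<le> u"
    then show "tilt s x0 p (x + y) - (p (x + s t x0) - t * p x0) \<le> p (y + s u x0) - u * p x0"
      using step[OF that, of u] by linarith
  qed
  then have "tilt s x0 p (x + y) - tilt s x0 p y \<le> tilt s x0 p x"
    by (intro tilt_greatest) (simp add: algebra_simps)
  then show "tilt s x0 p (x + y) \<le> tilt s x0 p x + tilt s x0 p y" by simp
next
  fix x and r :: real assume x: "x \<in> S" "0 \<le> r"
  show "tilt s x0 p (s r x) \<le> r * tilt s x0 p x"
  proof (cases "r = 0")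
    case True
    then show ?thesis using tilt_le[of 0 0] sublinear_0[OF p] by simp
  next
    case False
    have "tilt s x0 p (s r x) / r \<le> p (x + s t x0) - t * p x0" if "0 \<le> t" for t
    proof -
      have "tilt s x0 p (s r x) \<le> p (s r (x + s t x0)) - (r * t) * p x0"
        using tilt_le[of "s r x" "r * t"] x that by (simp add: scale_right_distrib)
      also have "\<dots> \<le> r * p (x + s t x0) - (r * t) * p x0"
        using sublinear_scale[OF p] x x0 by simp
      finally show ?thesis using x False by (simp add: field_simps)
    qed
    then have "tilt s x0 p (s r x) / r \<le> tilt s x0 p x" by (rule tilt_greatest)
    then show ?thesis using x False by (simp add: field_simps)
  qed
qed

end

text \<open>
  Zorn's lemma applies since all sublinear functionals below \<open>p\<close> are bounded from below by
  \<open>x \<mapsto> - p (- x)\<close>, so that a chain has a pointwise infimum.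
\<close>

lemma minimal_sublinear_exists:
  assumes p: "sublinear_on s S p"
  shows "\<exists>q. sublinear_on s S q \<and> (\<forall>x\<in>S. q x \<le> p x) \<and>
    (\<forall>q'. sublinear_on s S q' \<longrightarrow> (\<forall>x\<in>S. q' x \<le> q x) \<longrightarrow> (\<forall>x\<in>S. q' x = q x))"
proof -
  define A where "A = {q. sublinear_on s S q \<and> (\<forall>x\<in>S. q x \<le> p x) \<and> (\<forall>x. x \<notin> S \<longrightarrow> q x = 0)}"
  have cut: "sublinear_on s S (\<lambda>x. if x \<in> S then q x else 0)" if "sublinear_on s S q" for q
    using that by (auto simp: sublinear_on_def)
  have "\<exists>m\<in>A. \<forall>a\<in>A. a \<le> m \<longrightarrow> a = m"
  proof (rule predicate_Zorn[where P = "\<lambda>a b. b \<le> a"])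
    show "partial_order_on A (relation_of (\<lambda>a b. b \<le> a) A)"
      by (rule partial_order_on_relation_ofI) auto
  next
    fix C assume C: "C \<in> Chains (relation_of (\<lambda>a b. b \<le> a) A)"
    then have CA: "C \<subseteq> A" and chain: "\<And>a b. a \<in> C \<Longrightarrow> b \<in> C \<Longrightarrow> a \<le> b \<or> b \<le> a"
      by (auto simp: Chains_def relation_of_def)
    show "\<exists>u\<in>A. \<forall>a\<in>C. u \<le> a"
    proof (cases "C = {}")
      case True
      have "(\<lambda>x. if x \<in> S then p x else 0) \<in> A" using cut[OF p] by (simp add: A_def)
      with True show ?thesis by blast
    next
      case False
      define q where "q x = (INF c\<in>C. c x)" for x
      have sub: "sublinear_on s S c" "\<And>x. x \<in> S \<Longrightarrow> c x \<le> p x" "\<And>x. x \<notin> S \<Longrightarrow> c x = 0"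
        if "c \<in> C" for c
        using that CA by (auto simp: A_def)
      have q_le: "q x \<le> c x" if c: "c \<in> C" for c x
        unfolding q_def
      proof (rule cINF_lower[OF _ c])
        have "- \<bar>p (- x)\<bar> \<le> c x" if "c \<in> C" for c
        proof (cases "x \<in> S")
          case True
          then have "- c (- x) \<le> c x" "c (- x) \<le> p (- x)"
            using sublinear_neg[OF sub(1)] sub(2) that by auto
          then show ?thesis by simp
        qed (simp add: sub(3)[OF that])
        then show "bdd_below ((\<lambda>c. c x) ` C)" by (auto intro!: bdd_belowI2)
      qed
      have q_ge: "l \<le> q x" if "\<And>c. c \<in> C \<Longrightarrow> l \<le> c x" for l x
        unfolding q_def using False that by (intro cINF_greatest) auto
      have "sublinear_on s S q"
        unfolding sublinear_on_def
      proof (intro conjI ballI allI impI)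
        fix x y assume xy: "x \<in> S" "y \<in> S"
        have step: "q (x + y) \<le> c x + d y" if cd: "c \<in> C" "d \<in> C" for c d
        proof -
          obtain e where e: "e \<in> C" "e \<le> c" "e \<le> d" using chain[OF cd] cd by auto
          have "q (x + y) \<le> e (x + y)" using q_le e by blast
          also have "\<dots> \<le> e x + e y" using sublinear_add[OF sub(1)] e xy by blast
          also have "\<dots> \<le> c x + d y" using e by (simp add: add_mono le_funD)
          finally show ?thesis .
        qed
        have "q (x + y) - c x \<le> q y" if "c \<in> C" for c
          by (rule q_ge) (use step[OF that] in \<open>simp add: diff_le_eq add.commute\<close>)
        then have "q (x + y) - q y \<le> q x" by (intro q_ge) (simp add: algebra_simps)
        then show "q (x + y) \<le> q x + q y" by simp
      next
        fix x and r :: real assume x: "x \<in> S" "0 \<le> r"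
        have step: "q (s r x) \<le> r * c x" if "c \<in> C" for c
          using q_le[OF that] sublinear_scale[OF sub(1)[OF that] x] order_trans by blast
        show "q (s r x) \<le> r * q x"
        proof (cases "r = 0")
          case True
          with step False show ?thesis by auto
        next
          case r: False
          have "q (s r x) / r \<le> q x"
            using step x r by (intro q_ge) (simp add: field_simps)
          then show ?thesis using x r by (simp add: field_simps)
        qed
      qed
      moreover have "q x \<le> p x" if "x \<in> S" for x
        using False q_le sub(2)[OF _ that] order_trans by blast
      moreover have "q x = 0" if "x \<notin> S" for x
      proof (rule antisym)
        obtain c where "c \<in> C" using False by blast
        then show "q x \<le> 0" using q_le[of c x] sub(3)[of c, OF _ that] by simp
        show "0 \<le> q x"
        proof (rule q_ge)
          show "0 \<le> c x" if "c \<in> C" for c using sub(3)[OF that \<open>x \<notin> S\<close>] by simp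
        qed
      qed
      ultimately have "q \<in> A" by (simp add: A_def)
      then show ?thesis using q_le by (auto simp: le_fun_def)
    qed
  qed
  then obtain q where q: "q \<in> A" and min: "\<And>a. a \<in> A \<Longrightarrow> a \<le> q \<Longrightarrow> a = q" by blast
  show ?thesis
  proof (intro exI[of _ q] conjI allI impI ballI)
    show "q x \<le> p x" if "x \<in> S" for x using q that by (auto simp: A_def)
    show "sublinear_on s S q" using q by (auto simp: A_def)
  next
    fix q' x assume q': "sublinear_on s S q'" "\<forall>x\<in>S. q' x \<le> q x" and x: "x \<in> S"
    have "(\<lambda>x. if x \<in> S then q' x else 0) = q"
    proof (rule min)
      have "q' x \<le> p x" if "x \<in> S" for x
        using q q'(2) that order_trans[of "q' x" "q x" "p x"] by (simp add: A_def)
      then show "(\<lambda>x. if x \<in> S then q' x else 0) \<in> A"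
        using cut[OF q'(1)] by (simp add: A_def)
      show "(\<lambda>x. if x \<in> S then q' x else 0) \<le> q"
        using q q'(2) by (auto simp: A_def le_fun_def)
    qed
    from fun_cong[OF this, of x] x show "q' x = q x" by simp
  qed
qed

text \<open>
  A minimal sublinear functional is linear: it equals its own tilts, which forces
  \<open>q (- x) = - q x\<close>. Starting from the tilt of \<open>p\<close> at \<open>x0\<close> makes it agree with \<open>p\<close> at \<open>x0\<close>.
\<close>

lemma linear_support_functional:
  assumes p: "sublinear_on s S p" and x0: "x0 \<in> S"
  obtains u where "\<And>x y. x \<in> S \<Longrightarrow> y \<in> S \<Longrightarrow> u (x + y) = u x + u y"
    "\<And>r x. x \<in> S \<Longrightarrow> u (s r x) = r * u x" "\<And>x. x \<in> S \<Longrightarrow> u x \<le> p x" "u x0 = p x0"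
proof -
  from minimal_sublinear_exists[OF sublinear_tilt[OF p x0]]
  obtain q where q_all: "sublinear_on s S q \<and> (\<forall>x\<in>S. q x \<le> tilt s x0 p x) \<and>
    (\<forall>q'. sublinear_on s S q' \<longrightarrow> (\<forall>x\<in>S. q' x \<le> q x) \<longrightarrow> (\<forall>x\<in>S. q' x = q x))" ..
  then have q: "sublinear_on s S q" and q_le: "\<And>x. x \<in> S \<Longrightarrow> q x \<le> tilt s x0 p x" by auto
  have min: "q' x = q x" if "sublinear_on s S q'" "\<forall>x\<in>S. q' x \<le> q x" "x \<in> S" for q' x
    using conjunct2[OF conjunct2[OF q_all]] that by blast
  have neg: "q (- x) = - q x" if x: "x \<in> S" for x
  proof (rule antisym)
    have "q (- x) = tilt s x q (- x)"
      by (rule min[symmetric]) (use sublinear_tilt[OF q x] tilt_le_self[OF q x] x in auto)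
    also have "\<dots> \<le> - q x" by (rule tilt_neg[OF q x])
    finally show "q (- x) \<le> - q x" .
    show "- q x \<le> q (- x)" using sublinear_neg[OF q, of "- x"] x by simp
  qed
  have add: "q (x + y) = q x + q y" if "x \<in> S" "y \<in> S" for x y
  proof (rule antisym)
    show "q (x + y) \<le> q x + q y" using sublinear_add[OF q] that .
    have "- q (x + y) = q (- x + - y)" using neg[of "x + y"] that by (simp add: add.commute)
    also have "\<dots> \<le> - q x + - q y" using sublinear_add[OF q, of "- x" "- y"] neg that by simp
    finally show "q x + q y \<le> q (x + y)" by simp
  qed
  have pos: "q (s r x) = r * q x" if "x \<in> S" "0 \<le> r" for r x
  proof (rule antisym)
    show "q (s r x) \<le> r * q x" using sublinear_scale[OF q] that .
    show "r * q x \<le> q (s r x)"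
      using sublinear_scale[OF q, of "- x" r] that neg[of x] neg[of "s r x"] by simp
  qed
  show ?thesis
  proof (rule that)
    show "q (x + y) = q x + q y" if "x \<in> S" "y \<in> S" for x y using add that .
    show "q (s r x) = r * q x" if "x \<in> S" for r x
    proof (cases "0 \<le> r")
      case False
      then show ?thesis using pos[of x "- r"] neg[of "s r x"] that by simp
    qed (use pos that in auto)
    show "q x \<le> p x" if "x \<in> S" for x
      using q_le[OF that] tilt_le_self[OF p x0 that] by simp
    have "q x0 \<le> p x0" using q_le[OF x0] tilt_le_self[OF p x0 x0] by simp
    moreover have "p x0 \<le> q x0" using q_le[of "- x0"] tilt_neg[OF p x0] neg[OF x0] x0 by simp
    ultimately show "q x0 = p x0" by simp
  qed
qed

end

section \<open>Normed spaces and spaces of operators\<close>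

locale normed_nspace =
  fixes X :: "('k::real_or_complex, 'v::ab_group_add) nspace"
  assumes vector_space: "vector_space (scl X)"
    and subspace: "module.subspace (scl X) (carrier X)"
    and nrm_eq_0: "x \<in> carrier X \<Longrightarrow> nrm X x = 0 \<longleftrightarrow> x = 0"
    and nrm_triangle: "x \<in> carrier X \<Longrightarrow> y \<in> carrier X \<Longrightarrow> nrm X (x + y) \<le> nrm X x + nrm X y"
    and nrm_scl: "x \<in> carrier X \<Longrightarrow> nrm X (scl X c x) = norm c * nrm X x"
begin

sublocale VS: vector_space "scl X" by (rule vector_space)

lemma mem [simp]: "0 \<in> carrier X" "x \<in> carrier X \<Longrightarrow> y \<in> carrier X \<Longrightarrow> x + y \<in> carrier X"
  "x \<in> carrier X \<Longrightarrow> scl X c x \<in> carrier X" "x \<in> carrier X \<Longrightarrow> - x \<in> carrier X"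
  "x \<in> carrier X \<Longrightarrow> y \<in> carrier X \<Longrightarrow> x - y \<in> carrier X"
  using subspace by (auto simp: VS.subspace_0 VS.subspace_add VS.subspace_scale VS.subspace_neg VS.subspace_diff)

lemma nrm_0 [simp]: "nrm X 0 = 0"
  using nrm_eq_0 by simp

lemma nrm_minus [simp]: "x \<in> carrier X \<Longrightarrow> nrm X (- x) = nrm X x"
  using nrm_scl[of x "- 1"] by simp

lemma nrm_nonneg: "x \<in> carrier X \<Longrightarrow> 0 \<le> nrm X x"
  using nrm_triangle[of x "- x"] by simp

lemma nrm_diff_triangle:
  "x \<in> carrier X \<Longrightarrow> y \<in> carrier X \<Longrightarrow> nrm X (x - y) \<le> nrm X x + nrm X y"
  using nrm_triangle[of x "- y"] by simp

lemma nrm_diff_commute: "x \<in> carrier X \<Longrightarrow> y \<in> carrier X \<Longrightarrow> nrm X (x - y) = nrm X (y - x)"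
  using nrm_minus[of "x - y"] by simp

lemma normalize:
  assumes "x \<in> carrier X" "x \<noteq> 0"
  obtains y where "y \<in> unit_sphere X" "x = scl X (of_real (nrm X x)) y"
proof (rule that)
  have "nrm X x \<noteq> 0" using assms nrm_eq_0 by blast
  then show "scl X (of_real (1 / nrm X x)) x \<in> unit_sphere X"
    "x = scl X (of_real (nrm X x)) (scl X (of_real (1 / nrm X x)) x)"
    using assms nrm_nonneg[of x] by (auto simp: unit_sphere_def nrm_scl norm_divide simp flip: of_real_mult)
qed

lemma unit_sphere_exists:
  assumes "\<exists>x\<in>carrier X. x \<noteq> 0" obtains x where "x \<in> unit_sphere X"
  using assms normalize by metis

lemma unit_ball_0 [simp]: "0 \<in> unit_ball X"
  by (simp add: unit_ball_def)

end

lemma unit_sphere_subset: "x \<in> unit_sphere X \<Longrightarrow> x \<in> unit_ball X"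
  and unit_sphere_carrier: "x \<in> unit_sphere X \<Longrightarrow> x \<in> carrier X"
  and unit_ball_carrier: "x \<in> unit_ball X \<Longrightarrow> x \<in> carrier X"
  and unit_sphere_nrm: "x \<in> unit_sphere X \<Longrightarrow> nrm X x = 1"
  and unit_ball_nrm: "x \<in> unit_ball X \<Longrightarrow> nrm X x \<le> 1"
  by (auto simp: unit_sphere_def unit_ball_def)

lemma normed_if_banach: "banach_space X \<Longrightarrow> normed_nspace X"
  unfolding banach_space_def normed_nspace_def by blast

lemma normed_scalar_space: "normed_nspace (scalar_space :: ('k::real_or_complex, 'k) nspace)"
  by (intro normed_nspace.intro)
    (auto simp: scalar_space_def norm_mult norm_triangle_ineq
      intro: vector_space_over_itself.vector_space_axioms vector_space_over_itself.subspace_UNIV)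

lemma scalar_space_simps [simp]:
  "carrier scalar_space = UNIV" "scl scalar_space = (*)" "nrm scalar_space = norm"
  by (auto simp: scalar_space_def)

lemma op_space_simps [simp]:
  "carrier (op_space A Y) = {T. bounded_op A Y T}"
  "scl (op_space A Y) c T = (\<lambda>x. scl Y c (T x))"
  by (auto simp: op_space_def)

locale normed_pair = A: normed_nspace A + Y: normed_nspace Y
  for A :: "('k::real_or_complex, 'v::ab_group_add) nspace"
    and Y :: "('k, 'w::ab_group_add) nspace"
begin

lemma
  assumes "bounded_op A Y T"
  shows op_mem: "x \<in> carrier A \<Longrightarrow> T x \<in> carrier Y"
    and op_add: "x \<in> carrier A \<Longrightarrow> y \<in> carrier A \<Longrightarrow> T (x + y) = T x + T y"
    and op_scl: "x \<in> carrier A \<Longrightarrow> T (scl A c x) = scl Y c (T x)"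
    and op_off: "x \<notin> carrier A \<Longrightarrow> T x = 0"
  using assms by (auto simp: bounded_op_def)

lemma op_0: "bounded_op A Y T \<Longrightarrow> T 0 = 0"
  using op_add[of T 0 0] by simp

lemma op_minus: "bounded_op A Y T \<Longrightarrow> x \<in> carrier A \<Longrightarrow> T (- x) = - T x"
  using op_scl[of T x "-1"] by simp

lemma op_diff: "bounded_op A Y T \<Longrightarrow> x \<in> carrier A \<Longrightarrow> y \<in> carrier A \<Longrightarrow> T (x - y) = T x - T y"
  using op_add[of T x "-y"] op_minus[of T y] by simp

lemma op_mem': "bounded_op A Y T \<Longrightarrow> T x \<in> carrier Y"
  by (cases "x \<in> carrier A") (auto simp: op_mem op_off)

lemma op_nrm_le_onI:
  assumes "\<And>x. x \<in> unit_ball A \<Longrightarrow> nrm Y (T x) \<le> C"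
  shows "nrm (op_space A Y) T \<le> C"
proof -
  have "unit_ball A \<noteq> {}" using A.unit_ball_0 by blast
  then show ?thesis unfolding op_space_def using assms by (simp add: cSUP_least)
qed

lemma bdd_above_op_values:
  assumes T: "bounded_op A Y T" shows "bdd_above ((\<lambda>x. nrm Y (T x)) ` unit_ball A)"
proof -
  obtain C where C: "\<And>x. x \<in> carrier A \<Longrightarrow> nrm Y (T x) \<le> C * nrm A x"
    using T unfolding bounded_op_def by blast
  have "nrm Y (T x) \<le> \<bar>C\<bar>" if "x \<in> unit_ball A" for x
  proof -
    have "nrm Y (T x) \<le> C * nrm A x" using C that by (simp add: unit_ball_def)
    also have "\<dots> \<le> \<bar>C\<bar> * 1"
      using that A.nrm_nonneg[of x] by (intro mult_mono) (auto simp: unit_ball_def)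
    finally show ?thesis by simp
  qed
  then show ?thesis by (auto intro!: bdd_aboveI2)
qed

lemma op_ball_le:
  assumes "bounded_op A Y T" "x \<in> unit_ball A"
  shows "nrm Y (T x) \<le> nrm (op_space A Y) T"
  unfolding op_space_def using cSUP_upper[OF assms(2) bdd_above_op_values[OF assms(1)]] by simp

lemma op_nrm_nonneg: "bounded_op A Y T \<Longrightarrow> 0 \<le> nrm (op_space A Y) T"
  using op_ball_le[of T 0] by (simp add: op_0)

lemma op_le:
  assumes T: "bounded_op A Y T" and x: "x \<in> carrier A"
  shows "nrm Y (T x) \<le> nrm (op_space A Y) T * nrm A x"
proof (cases "x = 0")
  case False
  then obtain y where y: "y \<in> unit_sphere A" "x = scl A (of_real (nrm A x)) y"
    using A.normalize[OF x] by blast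
  then have "nrm Y (T x) = nrm A x * nrm Y (T y)"
    using op_scl[OF T, of y "of_real (nrm A x)"] Y.nrm_scl op_mem[OF T] A.nrm_nonneg[OF x]
    by (simp add: unit_sphere_carrier)
  then show ?thesis
    using op_ball_le[OF T unit_sphere_subset[OF y(1)]] A.nrm_nonneg[OF x]
    by (simp add: mult_left_mono mult.commute)
qed (simp add: op_0[OF T])

lemma bounded_opI:
  assumes "\<And>x. x \<in> carrier A \<Longrightarrow> T x \<in> carrier Y"
    and "\<And>x y. x \<in> carrier A \<Longrightarrow> y \<in> carrier A \<Longrightarrow> T (x + y) = T x + T y"
    and "\<And>c x. x \<in> carrier A \<Longrightarrow> T (scl A c x) = scl Y c (T x)"
    and "\<And>x. x \<in> carrier A \<Longrightarrow> nrm Y (T x) \<le> C * nrm A x"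
    and "\<And>x. x \<notin> carrier A \<Longrightarrow> T x = 0"
  shows "bounded_op A Y T"
  using assms unfolding bounded_op_def by blast

lemma op_nrm_leI:
  assumes "\<And>x. x \<in> carrier A \<Longrightarrow> nrm Y (T x) \<le> C * nrm A x" "0 \<le> C"
  shows "nrm (op_space A Y) T \<le> C"
proof (rule op_nrm_le_onI)
  fix x assume "x \<in> unit_ball A"
  then have "nrm Y (T x) \<le> C * nrm A x" "C * nrm A x \<le> C * 1"
    using assms mult_left_mono[of "nrm A x" 1 C] by (auto simp: unit_ball_def)
  then show "nrm Y (T x) \<le> C" by simp
qed

lemma bounded_op_add:
  assumes "bounded_op A Y T" "bounded_op A Y S" shows "bounded_op A Y (T + S)"
proof (rule bounded_opI[where C = "nrm (op_space A Y) T + nrm (op_space A Y) S"])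
  fix x assume x: "x \<in> carrier A"
  have "nrm Y ((T + S) x) \<le> nrm Y (T x) + nrm Y (S x)"
    using Y.nrm_triangle op_mem assms x by simp
  also have "\<dots> \<le> nrm (op_space A Y) T * nrm A x + nrm (op_space A Y) S * nrm A x"
    using op_le assms x by (intro add_mono)
  finally show "nrm Y ((T + S) x) \<le> (nrm (op_space A Y) T + nrm (op_space A Y) S) * nrm A x"
    by (simp add: algebra_simps)
qed (use assms in \<open>auto simp: op_mem op_add op_scl op_off Y.VS.scale_right_distrib algebra_simps\<close>)

lemma bounded_op_scl:
  assumes "bounded_op A Y T" shows "bounded_op A Y (\<lambda>x. scl Y c (T x))"
proof (rule bounded_opI[where C = "norm c * nrm (op_space A Y) T"])
  fix x assume x: "x \<in> carrier A"
  show "nrm Y (scl Y c (T x)) \<le> norm c * nrm (op_space A Y) T * nrm A x"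
    using op_le[OF assms x] op_mem[OF assms x] by (simp add: Y.nrm_scl mult.assoc mult_left_mono)
qed (use assms in \<open>auto simp: op_mem op_add op_scl op_off Y.VS.scale_right_distrib Y.VS.scale_left_commute\<close>)

lemma bounded_op_0: "bounded_op A Y 0"
  by (rule bounded_opI[where C = 0]) auto

lemma op_ext: "bounded_op A Y T \<Longrightarrow> bounded_op A Y S \<Longrightarrow> (\<And>x. x \<in> carrier A \<Longrightarrow> T x = S x) \<Longrightarrow> T = S"
  by (metis (full_types) ext op_off)

lemma vector_space_op: "vector_space (scl (op_space A Y))"
  by unfold_locales (auto simp: Y.VS.scale_right_distrib Y.VS.scale_left_distrib)

lemma normed_op_space: "normed_nspace (op_space A Y)"
proof -
  interpret V: vector_space "scl (op_space A Y)" by (rule vector_space_op)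
  show ?thesis
  proof
    show "V.subspace (carrier (op_space A Y))"
      unfolding V.subspace_def by (auto simp: bounded_op_0 bounded_op_add bounded_op_scl)
  next
    fix T assume "T \<in> carrier (op_space A Y)"
    then have T: "bounded_op A Y T" by simp
    show "nrm (op_space A Y) T = 0 \<longleftrightarrow> T = 0"
    proof
      assume 0: "nrm (op_space A Y) T = 0"
      show "T = 0"
      proof (rule op_ext[OF T bounded_op_0])
        fix x assume x: "x \<in> carrier A"
        have "nrm Y (T x) = 0" using op_le[OF T x] Y.nrm_nonneg[OF op_mem[OF T x]] 0 by simp
        then show "T x = 0 x" using Y.nrm_eq_0 op_mem[OF T x] by simp
      qed
    next
      assume "T = 0"
      then have "nrm (op_space A Y) T \<le> 0" by (intro op_nrm_le_onI) simp
      then show "nrm (op_space A Y) T = 0" using op_nrm_nonneg[OF T] by simp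
    qed
    fix c
    show "nrm (op_space A Y) (scl (op_space A Y) c T) = norm c * nrm (op_space A Y) T"
    proof -
      have le: "nrm (op_space A Y) (\<lambda>x. scl Y c (T x)) \<le> norm c * nrm (op_space A Y) T"
        if T: "bounded_op A Y T" for T c
        by (rule op_nrm_le_onI)
          (use op_ball_le[OF T] in \<open>simp add: Y.nrm_scl op_mem'[OF T] mult_left_mono\<close>)
      show ?thesis
      proof (cases "c = 0")
        case True
        then show ?thesis using le[OF T, of c] op_nrm_nonneg[OF bounded_op_scl[OF T, of c]] by simp
      next
        case False
        then have "nrm (op_space A Y) T \<le> norm (inverse c) * nrm (op_space A Y) (\<lambda>x. scl Y c (T x))"
          using le[OF bounded_op_scl[OF T, of c], of "inverse c"] by simp
        then have "norm c * nrm (op_space A Y) T \<le> nrm (op_space A Y) (\<lambda>x. scl Y c (T x))"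
          using False by (simp add: norm_divide norm_inverse field_simps)
        then show ?thesis using le[OF T, of c] by simp
      qed
    qed
  next
    fix T S assume "T \<in> carrier (op_space A Y)" "S \<in> carrier (op_space A Y)"
    then have T: "bounded_op A Y T" and S: "bounded_op A Y S" by simp_all
    show "nrm (op_space A Y) (T + S) \<le> nrm (op_space A Y) T + nrm (op_space A Y) S"
    proof (rule op_nrm_le_onI)
      fix x assume x: "x \<in> unit_ball A"
      have "nrm Y ((T + S) x) \<le> nrm Y (T x) + nrm Y (S x)"
        using Y.nrm_triangle op_mem' T S by simp
      also have "\<dots> \<le> nrm (op_space A Y) T + nrm (op_space A Y) S"
        using op_ball_le x T S by (intro add_mono)
      finally show "nrm Y ((T + S) x) \<le> nrm (op_space A Y) T + nrm (op_space A Y) S" .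
    qed
  qed
qed

end

lemma normed_nspace_subcarrier:
  assumes "normed_nspace Z" "C \<subseteq> carrier Z" "module.subspace (scl Z) C"
  shows "normed_nspace (Z\<lparr>carrier := C\<rparr>)"
proof -
  interpret normed_nspace Z by fact
  have C: "x \<in> carrier Z" if "x \<in> C" for x using assms(2) that by blast
  show ?thesis
    by unfold_locales
      (use assms(3) in \<open>simp_all add: C nrm_eq_0 nrm_triangle nrm_scl
         VS.scale_right_distrib VS.scale_left_distrib\<close>)
qed

lemma bounded_op_comp:
  assumes A: "normed_nspace A" and B: "normed_nspace B" and Y: "normed_nspace Y"
    and T: "bounded_op A B T" and S: "bounded_op B Y S"
  shows "bounded_op A Y (S \<circ> T)"
proof -
  interpret AB: normed_pair A B by (intro normed_pair.intro A B)
  interpret BY: normed_pair B Y by (intro normed_pair.intro B Y)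
  interpret AY: normed_pair A Y by (intro normed_pair.intro A Y)
  show ?thesis
  proof (rule AY.bounded_opI[where C = "nrm (op_space B Y) S * nrm (op_space A B) T"])
    fix x assume x: "x \<in> carrier A"
    have "nrm Y (S (T x)) \<le> nrm (op_space B Y) S * nrm B (T x)"
      using BY.op_le[OF S] AB.op_mem[OF T x] by blast
    also have "\<dots> \<le> nrm (op_space B Y) S * (nrm (op_space A B) T * nrm A x)"
      using AB.op_le[OF T x] BY.op_nrm_nonneg[OF S] by (rule mult_left_mono)
    finally show "nrm Y ((S \<circ> T) x) \<le> nrm (op_space B Y) S * nrm (op_space A B) T * nrm A x"
      by (simp add: mult.assoc)
  qed (use T S in \<open>auto simp: AB.op_mem AB.op_add AB.op_scl AB.op_off
      BY.op_mem BY.op_add BY.op_scl BY.op_0\<close>)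
qed

section \<open>Dual spaces and the Hahn--Banach theorem\<close>

context normed_nspace
begin

lemma dual_pair: "normed_pair X scalar_space"
  by (intro normed_pair.intro normed_nspace_axioms normed_scalar_space)

sublocale D: normed_pair X scalar_space by (rule dual_pair)

lemma normed_dual: "normed_nspace (dual X)"
  unfolding dual_def by (rule D.normed_op_space)

lemma dual_simps [simp]: "carrier (dual X) = {f. bounded_op X scalar_space f}"
  "scl (dual X) c f = (\<lambda>x. c * f x)"
  by (auto simp: dual_def)

lemma dual_le: "bounded_op X scalar_space f \<Longrightarrow> x \<in> carrier X \<Longrightarrow> norm (f x) \<le> nrm (dual X) f * nrm X x"
  using D.op_le by (simp add: dual_def)

lemma dual_sphere_le: "f \<in> unit_ball (dual X) \<Longrightarrow> x \<in> carrier X \<Longrightarrow> norm (f x) \<le> nrm X x"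
  using dual_le[of f x] mult_right_mono[of "nrm (dual X) f" 1 "nrm X x"] nrm_nonneg[of x]
  by (auto simp: unit_ball_def)

text \<open>
  The real functional \<open>u\<close> is the real part of the required one. In the complex case the
  latter is \<open>x \<mapsto> u x - i u (i x)\<close>. Its bound comes from \<open>u\<close> alone, as every value becomes
  real after \<open>x\<close> is multiplied by a scalar of modulus one.
\<close>

lemma functional_with_real_part:
  assumes u: "\<And>x y. x \<in> carrier X \<Longrightarrow> y \<in> carrier X \<Longrightarrow> u (x + y) = u x + u y"
    "\<And>r x. x \<in> carrier X \<Longrightarrow> u (scl X (of_real r) x) = r * u x"
  shows "\<exists>f :: 'v \<Rightarrow> 'k. (\<forall>x\<in>carrier X. \<forall>y\<in>carrier X. f (x + y) = f x + f y) \<and>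
    (\<forall>c. \<forall>x\<in>carrier X. f (scl X c x) = c * f x) \<and> (\<forall>x\<in>carrier X. re (f x) = u x)"
  using range_to_complex[where 'k='k]
proof
  assume real: "range (to_complex :: 'k \<Rightarrow> complex) = range complex_of_real"
  have "of_real (re c) = c" for c :: 'k
  proof -
    obtain r where "to_complex c = complex_of_real r" using real by blast
    then show ?thesis
      using to_complex_eq_iff[of "of_real (re c)" c] by (simp add: re_def to_complex_of_real)
  qed
  then have "of_real (u (scl X c x)) = c * of_real (u x)" if "x \<in> carrier X" for c x
    using u(2)[OF that, of "re c"] by (metis of_real_mult)
  then show ?thesis
    by (intro exI[of _ "\<lambda>x. of_real (u x)"]) (auto simp: u(1))
next
  assume "range (to_complex :: 'k \<Rightarrow> complex) = UNIV"
  then obtain j :: 'k where j: "to_complex j = \<i>" by (metis surjD)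
  have jj: "j * j = - 1"
    using to_complex_eq_iff[of "j * j" "- 1"]
    by (simp add: to_complex_mult to_complex_minus to_complex_1 j)
  have split: "c = of_real (re c) + of_real (Im (to_complex c)) * j" for c :: 'k
    using to_complex_eq_iff[of c "of_real (re c) + of_real (Im (to_complex c)) * j"]
    by (simp add: to_complex_mult to_complex_add to_complex_of_real j re_def complex_eq_iff)
  define f where "f x = (of_real (u x) - j * of_real (u (scl X j x)) :: 'k)" for x
  have add: "f (x + y) = f x + f y" if "x \<in> carrier X" "y \<in> carrier X" for x y
    using that by (simp add: f_def u(1) VS.scale_right_distrib algebra_simps)
  have real: "f (scl X (of_real r) x) = of_real r * f x" if "x \<in> carrier X" for r x
    using that u(2)[of "scl X j x" r] by (simp add: f_def u(2) mult.commute right_diff_distrib mult.left_commute)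
  have imag: "f (scl X j x) = j * f x" if "x \<in> carrier X" for x
  proof -
    have "u (scl X (j * j) x) = - u x" using u(2)[OF that, of "-1"] by (simp add: jj)
    then have "f (scl X j x) = of_real (u (scl X j x)) + j * of_real (u x)" by (simp add: f_def)
    also have "\<dots> = j * f x"
      by (simp add: f_def right_diff_distrib mult.assoc[symmetric] jj)
    finally show ?thesis .
  qed
  have "f (scl X c x) = c * f x" if "x \<in> carrier X" for c x
  proof -
    have "f (scl X c x) = f (scl X (of_real (re c)) x + scl X (of_real (Im (to_complex c))) (scl X j x))"
      using split[of c] by (metis VS.scale_left_distrib VS.scale_scale)
    also have "\<dots> = (of_real (re c) + of_real (Im (to_complex c)) * j) * f x"
      using that by (simp add: add real imag distrib_right mult.assoc del: VS.scale_scale)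
    finally show ?thesis using split[of c] by metis
  qed
  moreover have "re (f x) = u x" for x
    by (simp add: f_def re_def to_complex_diff to_complex_mult to_complex_of_real j)
  ultimately show ?thesis using add by blast
qed

lemma support_functional:
  assumes x0: "x0 \<in> carrier X" "x0 \<noteq> 0"
  obtains f where "f \<in> unit_sphere (dual X)" "f x0 = of_real (nrm X x0)"
proof -
  interpret R: real_subspace "\<lambda>r. scl X (of_real r)" "carrier X"
  proof -
    interpret R: vector_space "\<lambda>r. scl X (of_real r)"
      by unfold_locales (auto simp: VS.scale_right_distrib VS.scale_left_distrib)
    show "real_subspace (\<lambda>r. scl X (of_real r)) (carrier X)"
      by unfold_locales (auto simp: R.subspace_def)
  qed
  have "sublinear_on (\<lambda>r. scl X (of_real r)) (carrier X) (nrm X)"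
    by (auto simp: sublinear_on_def nrm_triangle nrm_scl)
  then obtain u where u: "\<And>x y. x \<in> carrier X \<Longrightarrow> y \<in> carrier X \<Longrightarrow> u (x + y) = u x + u y"
    "\<And>r x. x \<in> carrier X \<Longrightarrow> u (scl X (of_real r) x) = r * u x"
    "\<And>x. x \<in> carrier X \<Longrightarrow> u x \<le> nrm X x" "u x0 = nrm X x0"
    using R.linear_support_functional[of "nrm X" x0] x0(1) by blast
  obtain g :: "'v \<Rightarrow> 'k" where
    g: "\<forall>x\<in>carrier X. \<forall>y\<in>carrier X. g (x + y) = g x + g y"
       "\<forall>c. \<forall>x\<in>carrier X. g (scl X c x) = c * g x" "\<forall>x\<in>carrier X. re (g x) = u x"
    using functional_with_real_part[of u] u(1,2) by blast
  have bound: "norm (g x) \<le> nrm X x" if x: "x \<in> carrier X" for x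
  proof -
    obtain c where c: "norm c = 1" "c * g x = of_real (norm (g x))" by (rule unimodular_multiplier)
    have "norm (g x) = re (g (scl X c x))" using g(2) x c by simp
    also have "\<dots> \<le> nrm X (scl X c x)" using g(3) u(3) x by simp
    also have "\<dots> = nrm X x" using x c by (simp add: nrm_scl)
    finally show ?thesis .
  qed
  have gx0: "g x0 = of_real (nrm X x0)"
    using g(3) u(4) x0(1) bound[OF x0(1)] by (intro eq_of_real_if_re_eq_norm) auto
  define f where "f x = (if x \<in> carrier X then g x else 0)" for x
  have f: "bounded_op X scalar_space f"
    by (rule D.bounded_opI[where C = 1]) (use g bound in \<open>auto simp: f_def\<close>)
  have "nrm (dual X) f \<le> 1"
    unfolding dual_def by (rule D.op_nrm_leI) (auto simp: f_def bound)
  moreover have "1 \<le> nrm (dual X) f"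
  proof -
    have "0 < nrm X x0" using x0 nrm_nonneg nrm_eq_0 by fastforce
    moreover have "nrm X x0 \<le> nrm (dual X) f * nrm X x0"
      using dual_le[OF f x0(1)] x0(1) calculation by (simp add: f_def gx0)
    ultimately show ?thesis by simp
  qed
  ultimately have "f \<in> unit_sphere (dual X)" using f by (simp add: unit_sphere_def)
  moreover have "f x0 = of_real (nrm X x0)" using x0 gx0 by (simp add: f_def)
  ultimately show ?thesis by (rule that)
qed

lemma nrm_le_if_functionals_le:
  assumes x: "x \<in> carrier X" and "0 \<le> C" and le: "\<And>f. f \<in> unit_sphere (dual X) \<Longrightarrow> norm (f x) \<le> C"
  shows "nrm X x \<le> C"
proof (cases "x = 0")
  case False
  obtain f where "f \<in> unit_sphere (dual X)" "f x = of_real (nrm X x)"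
    by (rule support_functional[OF x False])
  then show ?thesis using le[of f] by simp
qed (use assms in simp)

lemma functionals_separate:
  assumes "x \<in> carrier X" "y \<in> carrier X" "\<And>f. bounded_op X scalar_space f \<Longrightarrow> f x = f y"
  shows "x = y"
proof -
  have "nrm X (x - y) \<le> 0"
  proof (rule nrm_le_if_functionals_le)
    fix f assume "f \<in> unit_sphere (dual X)"
    then have "bounded_op X scalar_space f" by (simp add: unit_sphere_def)
    then show "norm (f (x - y)) \<le> 0" using assms by (simp add: D.op_diff)
  qed (use assms in auto)
  then have "nrm X (x - y) = 0" using nrm_nonneg[of "x - y"] assms by simp
  then show ?thesis using nrm_eq_0[of "x - y"] assms by simp
qed

end

section \<open>Numerical radius and perturbations of the identity\<close>

context normed_nspace
begin

sublocale E: normed_pair X X by (intro normed_pair.intro normed_nspace_axioms)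

lemma identity_in_unit_sphere:
  assumes "\<exists>x\<in>carrier X. x \<noteq> 0"
  shows "(\<lambda>x. if x \<in> carrier X then x else 0) \<in> unit_sphere (op_space X X)"
proof -
  let ?I = "\<lambda>x. if x \<in> carrier X then x else 0"
  have I: "bounded_op X X ?I" by (rule E.bounded_opI[where C = 1]) auto
  obtain x where x: "x \<in> unit_sphere X" using unit_sphere_exists[OF assms] by blast
  have "nrm (op_space X X) ?I \<le> 1" by (rule E.op_nrm_leI) auto
  moreover have "1 \<le> nrm (op_space X X) ?I"
    using E.op_ball_le[OF I unit_sphere_subset[OF x]] x by (simp add: unit_sphere_def)
  ultimately show ?thesis using I by (simp add: unit_sphere_def)
qed

lemma numerical_radius_upper:
  assumes S: "bounded_op X X S" and xf: "x \<in> unit_sphere X" "f \<in> unit_sphere (dual X)" "f x = 1"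
  shows "norm (f (S x)) \<le> numerical_radius X S"
  unfolding numerical_radius_def
proof (rule cSup_upper)
  have "norm (f (S x)) \<le> nrm (op_space X X) S" if "x \<in> unit_sphere X" "f \<in> unit_sphere (dual X)" for x f
    using dual_sphere_le[OF unit_sphere_subset[OF that(2)], of "S x"]
      E.op_ball_le[OF S unit_sphere_subset[OF that(1)]] E.op_mem'[OF S, of x] by linarith
  then show "bdd_above {norm (f (S x)) |x f. x \<in> unit_sphere X \<and> f \<in> unit_sphere (dual X) \<and> f x = 1}"
    by (auto simp: bdd_above_def)
qed (use xf in blast)

lemma state_exists:
  assumes "x \<in> unit_sphere X" obtains f where "f \<in> unit_sphere (dual X)" "f x = 1"
proof -
  have "x \<noteq> 0" using assms by (auto simp: unit_sphere_def)
  then obtain f where "f \<in> unit_sphere (dual X)" "f x = of_real (nrm X x)"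
    using support_functional[OF unit_sphere_carrier[OF assms]] by blast
  then show ?thesis using that unit_sphere_nrm[OF assms] by simp
qed

lemma numerical_radius_least:
  assumes "\<exists>x\<in>carrier X. x \<noteq> 0"
    and "\<And>x f. x \<in> unit_sphere X \<Longrightarrow> f \<in> unit_sphere (dual X) \<Longrightarrow> f x = 1 \<Longrightarrow> norm (f (S x)) \<le> v"
  shows "numerical_radius X S \<le> v"
proof -
  obtain x where "x \<in> unit_sphere X" using unit_sphere_exists[OF assms(1)] by blast
  moreover then obtain f where "f \<in> unit_sphere (dual X)" "f x = 1" using state_exists by blast
  ultimately show ?thesis
    unfolding numerical_radius_def by (intro cSup_least) (use assms(2) in blast)+
qed

lemma numerical_radius_nonneg:
  assumes "\<exists>x\<in>carrier X. x \<noteq> 0" and S: "bounded_op X X S"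
  shows "0 \<le> numerical_radius X S"
proof -
  obtain x where x: "x \<in> unit_sphere X" using unit_sphere_exists[OF assms(1)] by blast
  then obtain f where "f \<in> unit_sphere (dual X)" "f x = 1" using state_exists by blast
  then show ?thesis using numerical_radius_upper[OF S x] norm_ge_zero order_trans by blast
qed

text \<open>
  At a norm-one vector \<open>x\<close> with supporting functional \<open>f\<close>, the value of \<open>f\<close> at \<open>x - c S x\<close>
  is at distance at most \<open>\<bar>c\<bar> v(S)\<close> from \<open>1\<close>.
\<close>

lemma numerical_radius_lower_estimate:
  assumes S: "bounded_op X X S" and x: "x \<in> carrier X"
  shows "(1 - norm c * numerical_radius X S) * nrm X x \<le> nrm X (x - scl X c (S x))"
proof (cases "x = 0")
  case False
  let ?v = "numerical_radius X S"
  obtain y where y: "y \<in> unit_sphere X" "x = scl X (of_real (nrm X x)) y"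
    using normalize[OF x False] by blast
  obtain f where f: "f \<in> unit_sphere (dual X)" "f y = 1" using state_exists[OF y(1)] by blast
  have yc: "y \<in> carrier X" and fb: "bounded_op X scalar_space f"
    using y f by (auto simp: unit_sphere_def)
  have Sy: "S y \<in> carrier X" using E.op_mem[OF S yc] .
  have "1 \<le> norm (f y - c * f (S y)) + norm (c * f (S y))"
    using norm_triangle_ineq[of "f y - c * f (S y)" "c * f (S y)"] f(2) by simp
  moreover have "norm (c * f (S y)) \<le> norm c * ?v"
    using numerical_radius_upper[OF S y(1) f] by (simp add: norm_mult mult_left_mono)
  moreover have "norm (f y - c * f (S y)) \<le> nrm X (y - scl X c (S y))"
    using dual_sphere_le[OF unit_sphere_subset[OF f(1)], of "y - scl X c (S y)"] yc Sy
      D.op_diff[OF fb yc, of "scl X c (S y)"] D.op_scl[OF fb Sy, of c] by simp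
  ultimately have "1 - norm c * ?v \<le> nrm X (y - scl X c (S y))" by linarith
  then have "nrm X x * (1 - norm c * ?v) \<le> nrm X x * nrm X (y - scl X c (S y))"
    using nrm_nonneg[OF x] by (rule mult_left_mono)
  also have "\<dots> = nrm X (scl X (of_real (nrm X x)) (y - scl X c (S y)))"
    using yc Sy nrm_nonneg[OF x] by (simp add: nrm_scl)
  also have "scl X (of_real (nrm X x)) (y - scl X c (S y)) = x - scl X c (S x)"
    using E.op_scl[OF S yc, of "of_real (nrm X x)"] y(2)
    by (simp add: VS.scale_right_diff_distrib mult.commute)
  finally show ?thesis by (simp add: mult.commute)
qed (simp add: E.op_0[OF S])

text \<open>
  Lumer's bound for \<open>\<parallel>I + c S\<parallel>\<close>: the preceding lower estimate is applied to the vector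
  \<open>x + c S x\<close>, for which the terms of first order cancel.
\<close>

lemma identity_perturbation_le:
  assumes S: "bounded_op X X S" and c: "norm c * numerical_radius X S < 1" and x: "x \<in> carrier X"
  shows "nrm X (x + scl X c (S x)) \<le>
    (1 + (norm c)\<^sup>2 * (nrm (op_space X X) S)\<^sup>2) / (1 - norm c * numerical_radius X S) * nrm X x"
proof -
  let ?v = "numerical_radius X S" and ?n = "nrm (op_space X X) S"
  have Sx: "S x \<in> carrier X" and SSx: "S (S x) \<in> carrier X" using E.op_mem'[OF S] by auto
  have "nrm X (S (S x)) \<le> ?n * nrm X (S x)" using E.op_le[OF S Sx] .
  also have "\<dots> \<le> ?n * (?n * nrm X x)"
    using E.op_le[OF S x] E.op_nrm_nonneg[OF S] by (rule mult_left_mono)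
  finally have SS: "nrm X (S (S x)) \<le> ?n\<^sup>2 * nrm X x" by (simp add: power2_eq_square mult.assoc)
  have "(1 - norm c * ?v) * nrm X (x + scl X c (S x)) \<le>
      nrm X ((x + scl X c (S x)) - scl X c (S (x + scl X c (S x))))"
    by (rule numerical_radius_lower_estimate[OF S]) (use x Sx in simp)
  also have "(x + scl X c (S x)) - scl X c (S (x + scl X c (S x))) = x - scl X (c * c) (S (S x))"
    using x Sx by (simp add: E.op_add[OF S] E.op_scl[OF S] VS.scale_right_distrib)
  also have "nrm X (x - scl X (c * c) (S (S x))) \<le> nrm X x + nrm X (scl X (c * c) (S (S x)))"
    using x SSx by (intro nrm_diff_triangle) auto
  also have "nrm X (scl X (c * c) (S (S x))) = (norm c)\<^sup>2 * nrm X (S (S x))"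
    using SSx by (simp add: nrm_scl norm_mult power2_eq_square)
  also have "nrm X x + (norm c)\<^sup>2 * nrm X (S (S x)) \<le> (1 + (norm c)\<^sup>2 * ?n\<^sup>2) * nrm X x"
    using mult_left_mono[OF SS, of "(norm c)\<^sup>2"] by (simp add: algebra_simps)
  finally show ?thesis using c by (simp add: field_simps)
qed

end

text \<open>
  Both sides of the inequality are \<open>1\<close> for \<open>a = 0\<close>, and their slopes there are \<open>w\<close> and \<open>v\<close>.
\<close>

lemma le_if_quadratic_perturbation:
  fixes v w K :: real
  assumes "0 \<le> v" "0 \<le> w" "0 \<le> K"
    and le: "\<And>a. 0 < a \<Longrightarrow> a * v < 1 \<Longrightarrow> 1 + a * w \<le> (1 + a\<^sup>2 * K) / (1 - a * v)"
  shows "w \<le> v"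
proof (rule ccontr)
  assume "\<not> w \<le> v"
  then have wv: "v < w" by simp
  have pos: "0 < 1 + K + w * v" using assms by (simp add: add_pos_nonneg)
  \<comment> \<open>The inequality amounts to \<open>w - v \<le> a (K + w v)\<close>, which this \<open>a\<close> violates.\<close>
  define a where "a = (w - v) / (2 * (1 + K + w * v))"
  have a: "0 < a" using wv pos by (simp add: a_def)
  define s where "s = 1 + K + w * v"
  have a_eq: "a * (1 + K + w * v) = (w - v) / 2"
    using pos unfolding a_def s_def[symmetric] by simp
  have "(w - v) * v < 2 * (1 + K + w * v)"
  proof -
    have "(w - v) * v \<le> w * v" using assms by (simp add: algebra_simps)
    also have "\<dots> < 1 + K + w * v" using assms(3) by simp
    also have "\<dots> < 2 * (1 + K + w * v)" using pos unfolding s_def[symmetric] by simp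
    finally show ?thesis .
  qed
  then have av: "a * v < 1" using pos by (simp add: a_def field_simps)
  have "(1 + a * w) * (1 - a * v) \<le> 1 + a\<^sup>2 * K" using le[OF a av] av by (simp add: field_simps)
  then have "a * (w - v) \<le> a * (a * (K + w * v))" by (simp add: algebra_simps power2_eq_square)
  then have "w - v \<le> a * (K + w * v)" using a by simp
  also have "\<dots> \<le> a * (1 + K + w * v)" using a by simp
  finally show False using a_eq wv by simp
qed

text \<open>
  The operator \<open>P\<close> on \<open>Z\<close> is a copy of the operator \<open>S\<close> on \<open>A\<close> in the sense that every
  combination \<open>d I + c P\<close> has at most the norm of \<open>d I + c S\<close>.
\<close>

definition pencil_dominated ::
  "('k::real_or_complex, 'v::ab_group_add) nspace \<Rightarrow> ('v \<Rightarrow> 'v) \<Rightarrow>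
   ('k, 'w::ab_group_add) nspace \<Rightarrow> ('w \<Rightarrow> 'w) \<Rightarrow> bool" where
  "pencil_dominated A S Z P \<longleftrightarrow> (\<forall>d c C. 0 \<le> C \<longrightarrow>
     (\<forall>x\<in>carrier A. nrm A (scl A d x + scl A c (S x)) \<le> C * nrm A x) \<longrightarrow>
     (\<forall>z\<in>carrier Z. nrm Z (scl Z d z + scl Z c (P z)) \<le> C * nrm Z z))"

text \<open>
  At a state \<open>F\<close> of \<open>Z\<close> the numerical value of \<open>P\<close> is the first-order growth of
  \<open>\<parallel>I + c P\<parallel>\<close> for a suitable direction of \<open>c\<close>, which Lumer's bound for \<open>S\<close> controls.
\<close>

lemma numerical_radius_le_if_pencil_dominated:
  assumes A: "normed_nspace A" "\<exists>x\<in>carrier A. x \<noteq> 0" and Z: "normed_nspace Z" "\<exists>z\<in>carrier Z. z \<noteq> 0"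
    and S: "bounded_op A A S" and P: "bounded_op Z Z P" and dom: "pencil_dominated A S Z P"
  shows "numerical_radius Z P \<le> numerical_radius A S"
proof -
  interpret A: normed_nspace A by fact
  interpret Z: normed_nspace Z by fact
  show ?thesis
  proof (rule Z.numerical_radius_least[OF Z(2)])
    fix z F assume z: "z \<in> unit_sphere Z" and F: "F \<in> unit_sphere (dual Z)" "F z = 1"
    let ?v = "numerical_radius A S" and ?n = "nrm (op_space A A) S"
    have zc: "z \<in> carrier Z" and Pz: "P z \<in> carrier Z" and Fb: "bounded_op Z scalar_space F"
      using z F Z.E.op_mem'[OF P] by (auto simp: unit_sphere_def)
    show "norm (F (P z)) \<le> ?v"
    proof (rule le_if_quadratic_perturbation[where K = "?n\<^sup>2"])
      show "0 \<le> ?v" by (rule A.numerical_radius_nonneg[OF A(2) S])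
    next
      fix a :: real assume a: "0 < a" "a * ?v < 1"
      obtain u where u: "norm u = 1" "u * F (P z) = of_real (norm (F (P z)))"
        by (rule unimodular_multiplier)
      define c where "c = of_real a * u"
      have c: "norm c = a" using a u by (simp add: c_def norm_mult)
      let ?C = "(1 + a\<^sup>2 * ?n\<^sup>2) / (1 - a * ?v)"
      have "\<forall>x\<in>carrier A. nrm A (scl A 1 x + scl A c (S x)) \<le> ?C * nrm A x"
        using A.identity_perturbation_le[OF S, of c] a unfolding c by simp
      moreover have "0 \<le> ?C" using a by (intro divide_nonneg_nonneg) (auto simp: add_nonneg_nonneg)
      ultimately have "nrm Z (scl Z 1 z + scl Z c (P z)) \<le> ?C * nrm Z z"
        using dom zc unfolding pencil_dominated_def by blast
      then have "nrm Z (z + scl Z c (P z)) \<le> ?C" using z by (simp add: unit_sphere_def)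
      moreover have "norm (F (z + scl Z c (P z))) \<le> nrm Z (z + scl Z c (P z))"
        using Z.dual_sphere_le[OF unit_sphere_subset[OF F(1)]] zc Pz by simp
      moreover have "F (z + scl Z c (P z)) = of_real (1 + a * norm (F (P z)))"
        using zc Pz u(2) F(2)
        by (simp add: Z.D.op_add[OF Fb] Z.D.op_scl[OF Fb] c_def mult.assoc)
      moreover have "norm (of_real (1 + a * norm (F (P z))) :: 'a) = 1 + a * norm (F (P z))"
        using a by (simp only: norm_of_real) (simp add: add_nonneg_nonneg)
      ultimately show "1 + a * norm (F (P z)) \<le> ?C" by simp
    qed auto
  qed
qed

text \<open>
  Domination with \<open>d = 0\<close> and \<open>c = 1\<close> gives \<open>\<parallel>P\<parallel> \<le> \<parallel>S\<parallel>\<close>, and the last condition on \<open>P\<close> gives the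
  converse inequality.
\<close>

lemma numerical_index_le_if_pencil_dominated:
  assumes A: "normed_nspace A" "\<exists>x\<in>carrier A. x \<noteq> 0" and Z: "normed_nspace Z" "\<exists>z\<in>carrier Z. z \<noteq> 0"
    and ex: "\<And>S. S \<in> unit_sphere (op_space A A) \<Longrightarrow> \<exists>P.
      (\<forall>z\<in>carrier Z. P z \<in> carrier Z) \<and>
      (\<forall>z\<in>carrier Z. \<forall>w\<in>carrier Z. P (z + w) = P z + P w) \<and>
      (\<forall>c. \<forall>z\<in>carrier Z. P (scl Z c z) = scl Z c (P z)) \<and>
      pencil_dominated A S Z P \<and>
      (\<forall>a\<in>unit_ball A. \<exists>z\<in>unit_ball Z. nrm A (S a) \<le> nrm Z (P z))"
  shows "numerical_index Z \<le> numerical_index A"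
  unfolding numerical_index_def[of A]
proof (rule cINF_greatest)
  interpret A: normed_nspace A by fact
  interpret Z: normed_nspace Z by fact
  show "unit_sphere (op_space A A) \<noteq> {}" using A.identity_in_unit_sphere[OF A(2)] by blast
  fix S assume S: "S \<in> unit_sphere (op_space A A)"
  then have Sb: "bounded_op A A S" and S1: "nrm (op_space A A) S = 1" by (auto simp: unit_sphere_def)
  obtain P0 where P0: "\<And>z. z \<in> carrier Z \<Longrightarrow> P0 z \<in> carrier Z"
    "\<And>z w. z \<in> carrier Z \<Longrightarrow> w \<in> carrier Z \<Longrightarrow> P0 (z + w) = P0 z + P0 w"
    "\<And>c z. z \<in> carrier Z \<Longrightarrow> P0 (scl Z c z) = scl Z c (P0 z)"
    and dom0: "pencil_dominated A S Z P0"
    and large: "\<And>a. a \<in> unit_ball A \<Longrightarrow> \<exists>z\<in>unit_ball Z. nrm A (S a) \<le> nrm Z (P0 z)"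
    using ex[OF S] by blast
  define P where "P z = (if z \<in> carrier Z then P0 z else 0)" for z
  have dom: "pencil_dominated A S Z P"
    using dom0 by (auto simp: pencil_dominated_def P_def)
  have le: "nrm Z (P z) \<le> 1 * nrm Z z" if z: "z \<in> carrier Z" for z
  proof -
    have "\<forall>x\<in>carrier A. nrm A (scl A 0 x + scl A 1 (S x)) \<le> 1 * nrm A x"
      using A.E.op_le[OF Sb] S1 by simp
    then have "\<forall>z\<in>carrier Z. nrm Z (scl Z 0 z + scl Z 1 (P z)) \<le> 1 * nrm Z z"
      using dom zero_le_one unfolding pencil_dominated_def by blast
    then show ?thesis using z by simp
  qed
  have P: "bounded_op Z Z P"
    by (rule Z.E.bounded_opI[where C = 1]) (use P0 le in \<open>auto simp: P_def\<close>)
  have "nrm (op_space Z Z) P \<le> 1" by (rule Z.E.op_nrm_leI) (use le in auto)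
  moreover have "1 \<le> nrm (op_space Z Z) P"
  proof -
    have "nrm A (S a) \<le> nrm (op_space Z Z) P" if a: "a \<in> unit_ball A" for a
    proof -
      obtain z where z: "z \<in> unit_ball Z" "nrm A (S a) \<le> nrm Z (P0 z)" using large[OF a] by blast
      then show ?thesis using Z.E.op_ball_le[OF P z(1)] by (simp add: P_def unit_ball_carrier)
    qed
    then show ?thesis using A.E.op_nrm_le_onI[of S] S1 by metis
  qed
  ultimately have "P \<in> unit_sphere (op_space Z Z)" using P by (simp add: unit_sphere_def)
  moreover have "bdd_below (numerical_radius Z ` unit_sphere (op_space Z Z))"
    using Z.numerical_radius_nonneg[OF Z(2)] by (auto intro!: bdd_belowI2 simp: unit_sphere_def)
  ultimately have "numerical_index Z \<le> numerical_radius Z P"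
    unfolding numerical_index_def by (intro cINF_lower)
  also have "\<dots> \<le> numerical_radius A S"
    by (rule numerical_radius_le_if_pencil_dominated[OF A Z Sb P dom])
  finally show "numerical_index Z \<le> numerical_radius A S" .
qed

section \<open>The unit ball in the bidual\<close>

text \<open>
  The inner product of the complex numbers, pulled back to the scalar field.
\<close>

lemma conjugation_exists:
  "\<exists>k :: 'k::real_or_complex \<Rightarrow> 'k. \<forall>a b. re (k a * b) = Re (cnj (to_complex a) * to_complex b)"
proof -
  have "\<forall>a :: 'k. \<exists>b :: 'k. to_complex b = cnj (to_complex a)" using conjugate_exists by blast
  then obtain k :: "'k \<Rightarrow> 'k" where "\<And>a. to_complex (k a) = cnj (to_complex a)" by metis
  then show ?thesis by (intro exI[of _ k]) (simp add: re_def to_complex_mult)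
qed

lemma norm_diff_scaled_square:
  fixes r d :: "'k::real_or_complex"
  shows "(norm (r - of_real t * d))\<^sup>2 =
    (norm r)\<^sup>2 - 2 * t * Re (cnj (to_complex r) * to_complex d) + t\<^sup>2 * (norm d)\<^sup>2"
proof -
  have "(norm x)\<^sup>2 = (Re (to_complex x))\<^sup>2 + (Im (to_complex x))\<^sup>2" for x :: 'k
    using cmod_power2[of "to_complex x"] by (simp add: cmod_to_complex)
  then show ?thesis
    by (simp add: to_complex_diff to_complex_mult to_complex_of_real power2_eq_square algebra_simps)
qed

context normed_nspace
begin

lemma functional_combination:
  assumes f: "\<And>i. i \<in> I \<Longrightarrow> bounded_op X scalar_space (f i)"
  shows "bounded_op X scalar_space (\<lambda>x. \<Sum>i\<in>I. c i * f i x)"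
    and "\<xi> \<in> carrier (dual (dual X)) \<Longrightarrow> \<xi> (\<lambda>x. \<Sum>i\<in>I. c i * f i x) = (\<Sum>i\<in>I. c i * \<xi> (f i))"
proof -
  interpret DD: normed_nspace "dual X" by (rule normed_dual)
  have "bounded_op X scalar_space (\<lambda>x. \<Sum>i\<in>I. c i * f i x) \<and>
    (\<xi> \<in> carrier (dual (dual X)) \<longrightarrow> \<xi> (\<lambda>x. \<Sum>i\<in>I. c i * f i x) = (\<Sum>i\<in>I. c i * \<xi> (f i)))"
    using f
  proof (induction I rule: infinite_finite_induct)
    case (insert i I)
    let ?g = "\<lambda>x. c i * f i x" and ?h = "\<lambda>x. \<Sum>i\<in>I. c i * f i x"
    have eq: "(\<lambda>x. \<Sum>i\<in>insert i I. c i * f i x) = ?g + ?h" using insert.hyps by auto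
    have fi: "bounded_op X scalar_space (f i)" and h: "bounded_op X scalar_space ?h"
      using insert by auto
    have g: "bounded_op X scalar_space ?g" using D.bounded_op_scl[OF fi, of "c i"] by simp
    have "\<xi> (?g + ?h) = c i * \<xi> (f i) + (\<Sum>i\<in>I. c i * \<xi> (f i))"
      if \<xi>: "\<xi> \<in> carrier (dual (dual X))"
    proof -
      have b: "bounded_op (dual X) scalar_space \<xi>" using \<xi> by simp
      have "\<xi> (scl (dual X) (c i) (f i)) = c i * \<xi> (f i)"
        using DD.D.op_scl[OF b, of "f i"] fi by simp
      then show ?thesis using DD.D.op_add[OF b, of ?g ?h] g h insert \<xi> by simp
    qed
    then show ?case unfolding eq using D.bounded_op_add[OF g h] insert.hyps by simp
  qed (auto simp: D.bounded_op_0[unfolded zero_fun_def] DD.D.op_0[unfolded zero_fun_def])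
  then show "bounded_op X scalar_space (\<lambda>x. \<Sum>i\<in>I. c i * f i x)"
    and "\<xi> \<in> carrier (dual (dual X)) \<Longrightarrow> \<xi> (\<lambda>x. \<Sum>i\<in>I. c i * f i x) = (\<Sum>i\<in>I. c i * \<xi> (f i))"
    by blast+
qed

lemma unit_ball_convex:
  assumes "x \<in> unit_ball X" "y \<in> unit_ball X" "0 \<le> t" "t \<le> 1"
  shows "x + scl X (of_real t) (y - x) \<in> unit_ball X"
proof -
  have c: "x \<in> carrier X" "y \<in> carrier X" using assms by (auto simp: unit_ball_def)
  have "x + scl X (of_real t) (y - x) = scl X (of_real (1 - t)) x + scl X (of_real t) y"
    by (simp add: VS.scale_left_diff_distrib VS.scale_right_diff_distrib)
  moreover have "nrm X (scl X (of_real (1 - t)) x + scl X (of_real t) y) \<le>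
      nrm X (scl X (of_real (1 - t)) x) + nrm X (scl X (of_real t) y)"
    using c by (intro nrm_triangle) auto
  moreover have "nrm X (scl X (of_real (1 - t)) x) + nrm X (scl X (of_real t) y) =
      (1 - t) * nrm X x + t * nrm X y"
    using c assms norm_of_real[of "1 - t", where 'a='k] by (simp add: nrm_scl)
  moreover have "(1 - t) * nrm X x + t * nrm X y \<le> (1 - t) * 1 + t * 1"
    using assms by (intro add_mono mult_left_mono) (auto simp: unit_ball_def)
  ultimately show ?thesis using c by (simp add: unit_ball_def)
qed

lemma functional_nrm_le_if_re_le:
  assumes F: "bounded_op X scalar_space F" and le: "\<And>x. x \<in> unit_ball X \<Longrightarrow> re (F x) \<le> B"
  shows "nrm (dual X) F \<le> B"
  unfolding dual_def
proof (rule D.op_nrm_le_onI)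
  fix x assume x: "x \<in> unit_ball X"
  obtain c where c: "norm c = 1" "c * F x = of_real (norm (F x))" by (rule unimodular_multiplier)
  have "scl X c x \<in> unit_ball X" using x c by (simp add: unit_ball_def nrm_scl)
  moreover have "re (F (scl X c x)) = norm (F x)"
    using D.op_scl[OF F unit_ball_carrier[OF x], of c] c by simp
  ultimately show "nrm scalar_space (F x) \<le> B" using le[of "scl X c x"] by simp
qed

text \<open>
  Goldstine's theorem. If the conclusion fails, the sum of squares \<open>\<Sum>\<bar>f\<^sub>i x - \<xi> f\<^sub>i\<bar>\<^sup>2\<close> has a positive
  infimum over the ball. At an almost minimal point \<open>x\<^sub>0\<close> with residuals
  \<open>r\<^sub>i = \<xi> f\<^sub>i - f\<^sub>i x\<^sub>0\<close>, convexity of the ball makes \<open>x\<^sub>0\<close> an almost maximal point of the real part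
  of the functional \<open>F = \<Sum> cnj r\<^sub>i f\<^sub>i\<close>. The norm of \<open>F\<close> is thus almost \<open>re (F x\<^sub>0)\<close>, while
  \<open>re (\<xi> F)\<close> exceeds \<open>re (F x\<^sub>0)\<close> by \<open>\<Sum>\<bar>r\<^sub>i\<bar>\<^sup>2\<close>, which contradicts \<open>\<parallel>\<xi>\<parallel> \<le> 1\<close>.
\<close>

lemma goldstine:
  assumes \<xi>: "\<xi> \<in> unit_ball (dual (dual X))" and I: "finite I"
    and f: "\<And>i. i \<in> I \<Longrightarrow> bounded_op X scalar_space (f i)" and e: "0 < e"
  shows "\<exists>x\<in>unit_ball X. \<forall>i\<in>I. norm (f i x - \<xi> (f i)) < e"
proof (rule ccontr)
  assume no: "\<not> ?thesis"
  interpret DD: normed_nspace "dual X" by (rule normed_dual)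
  have \<xi>b: "bounded_op (dual X) scalar_space \<xi>" using \<xi> by (simp add: unit_ball_def DD.dual_simps)
  define q where "q x = (\<Sum>i\<in>I. (norm (f i x - \<xi> (f i)))\<^sup>2)" for x
  define D where "D = (INF x\<in>unit_ball X. q x)"
  have q_ge: "e\<^sup>2 \<le> q x" if x: "x \<in> unit_ball X" for x
  proof -
    obtain i where i: "i \<in> I" "e \<le> norm (f i x - \<xi> (f i))" using no x by (meson not_less)
    have "e\<^sup>2 \<le> (norm (f i x - \<xi> (f i)))\<^sup>2" using i e by (simp add: power_mono)
    also have "\<dots> \<le> q x" unfolding q_def using i I by (intro member_le_sum) auto
    finally show ?thesis .
  qed
  have ne: "unit_ball X \<noteq> {}" using unit_ball_0 by blast
  have D_pos: "0 < D"
    using cINF_greatest[OF ne q_ge] e unfolding D_def by (meson less_le_trans zero_less_power)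
  have D_le: "D \<le> q x" if "x \<in> unit_ball X" for x
    unfolding D_def using q_ge that by (intro cINF_lower) (auto intro!: bdd_belowI2)
  define M where "M = 1 + (\<Sum>i\<in>I. (2 * nrm (dual X) (f i))\<^sup>2)"
  have M: "0 < M" by (simp add: M_def add_pos_nonneg sum_nonneg)
  have diff_le: "(\<Sum>i\<in>I. (norm (f i x - f i y))\<^sup>2) \<le> M" if xy: "x \<in> unit_ball X" "y \<in> unit_ball X" for x y
  proof -
    have "(norm (f i x - f i y))\<^sup>2 \<le> (2 * nrm (dual X) (f i))\<^sup>2" if i: "i \<in> I" for i
    proof (rule power_mono)
      have "norm (f i x - f i y) \<le> norm (f i x) + norm (f i y)" by (rule norm_triangle_ineq4)
      also have "\<dots> \<le> nrm (dual X) (f i) + nrm (dual X) (f i)"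
        using D.op_ball_le[OF f[OF i]] xy unfolding dual_def by (intro add_mono) auto
      finally show "norm (f i x - f i y) \<le> 2 * nrm (dual X) (f i)" by simp
    qed simp
    then have "(\<Sum>i\<in>I. (norm (f i x - f i y))\<^sup>2) \<le> (\<Sum>i\<in>I. (2 * nrm (dual X) (f i))\<^sup>2)"
      by (rule sum_mono)
    then show ?thesis by (simp add: M_def)
  qed
  \<comment> \<open>The step \<open>t\<close> and the defect \<open>t\<^sup>2 M\<close> of \<open>x0\<close> make the final error \<open>t M\<close> smaller than \<open>D\<close>.\<close>
  define t where "t = min 1 (D / (2 * M))"
  have t: "0 < t" "t \<le> 1" using D_pos M by (auto simp: t_def)
  have tM: "t * M < D"
  proof -
    have "t * M \<le> D / (2 * M) * M" using M by (intro mult_right_mono) (auto simp: t_def)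
    then show ?thesis using D_pos M by simp
  qed
  have "0 < t\<^sup>2 * M" using t M by simp
  then have "\<exists>x\<in>unit_ball X. q x < D + t\<^sup>2 * M"
    using cINF_greatest[OF ne, of "D + t\<^sup>2 * M" q] unfolding D_def by (meson less_add_same_cancel1 not_le)
  then obtain x0 where x0: "x0 \<in> unit_ball X" "q x0 < D + t\<^sup>2 * M" by blast
  define r where "r i = \<xi> (f i) - f i x0" for i
  obtain k :: "'k \<Rightarrow> 'k"
    where k: "\<forall>a b. re (k a * b) = Re (cnj (to_complex a) * to_complex b)"
    using conjugation_exists ..
  have sq: "re (k a * a) = (norm a)\<^sup>2" for a
  proof -
    have "re (k a * a) = (cmod (to_complex a))\<^sup>2"
      unfolding k[rule_format] cmod_power2 by (simp add: power2_eq_square)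
    then show ?thesis by (simp add: cmod_to_complex)
  qed
  define F where "F = (\<lambda>x. \<Sum>i\<in>I. k (r i) * f i x)"
  have F: "bounded_op X scalar_space F" unfolding F_def by (rule functional_combination(1)[OF f])
  have \<xi>F: "\<xi> F = (\<Sum>i\<in>I. k (r i) * \<xi> (f i))"
    unfolding F_def by (rule functional_combination(2)[OF f]) (use \<xi>b in simp_all)
  have x0c: "x0 \<in> carrier X" by (rule unit_ball_carrier[OF x0(1)])
  have re_le: "re (F x) \<le> re (F x0) + t * M" if x: "x \<in> unit_ball X" for x
  proof -
    have xc: "x \<in> carrier X" by (rule unit_ball_carrier[OF x])
    let ?y = "x0 + scl X (of_real t) (x - x0)"
    have "D \<le> q ?y" using D_le unit_ball_convex[OF x0(1) x] t by simp
    also have "q ?y = (\<Sum>i\<in>I. (norm (r i - of_real t * (f i x - f i x0)))\<^sup>2)"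
      unfolding q_def
    proof (rule sum.cong)
      fix i assume i: "i \<in> I"
      have "f i ?y = f i x0 + of_real t * (f i x - f i x0)"
        using D.op_add[OF f[OF i]] D.op_scl[OF f[OF i]] D.op_diff[OF f[OF i]] x0c xc by simp
      then have "f i ?y - \<xi> (f i) = - (r i - of_real t * (f i x - f i x0))" by (simp add: r_def)
      then show "(norm (f i ?y - \<xi> (f i)))\<^sup>2 = (norm (r i - of_real t * (f i x - f i x0)))\<^sup>2"
        by (simp only: norm_minus_cancel)
    qed simp
    also have "\<dots> = (\<Sum>i\<in>I. (norm (r i))\<^sup>2) - 2 * t * (\<Sum>i\<in>I. re (k (r i) * (f i x - f i x0))) +
        t\<^sup>2 * (\<Sum>i\<in>I. (norm (f i x - f i x0))\<^sup>2)"
      unfolding norm_diff_scaled_square k[rule_format, symmetric]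
      by (simp add: sum.distrib sum_subtractf sum_distrib_left)
    also have "(\<Sum>i\<in>I. (norm (r i))\<^sup>2) = q x0"
      by (simp add: q_def r_def norm_minus_commute)
    also have "(\<Sum>i\<in>I. re (k (r i) * (f i x - f i x0))) = re (F x) - re (F x0)"
      by (simp add: F_def re_sum re_diff right_diff_distrib sum_subtractf)
    finally have "2 * t * (re (F x) - re (F x0)) \<le> q x0 - D + t\<^sup>2 * (\<Sum>i\<in>I. (norm (f i x - f i x0))\<^sup>2)"
      by simp
    also have "\<dots> \<le> t\<^sup>2 * M + t\<^sup>2 * M"
      using x0(2) mult_left_mono[OF diff_le[OF x x0(1)] zero_le_power2[of t]] by linarith
    finally have "2 * t * (re (F x) - re (F x0)) \<le> 2 * t * (t * M)" by (simp add: power2_eq_square ac_simps)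
    then have "re (F x) - re (F x0) \<le> t * M" using t by simp
    then show ?thesis by simp
  qed
  have "re (\<xi> F) \<le> norm (\<xi> F)" by (rule re_le_norm)
  also have "\<dots> \<le> nrm (dual X) F" using DD.dual_sphere_le[OF \<xi>] F by simp
  also have "\<dots> \<le> re (F x0) + t * M" by (rule functional_nrm_le_if_re_le[OF F re_le])
  finally have "re (\<xi> F) - re (F x0) \<le> t * M" by simp
  moreover have "re (\<xi> F) - re (F x0) = q x0"
  proof -
    have "F x0 = (\<Sum>i\<in>I. k (r i) * f i x0)" by (simp add: F_def)
    then have "re (\<xi> F) - re (F x0) = (\<Sum>i\<in>I. re (k (r i) * r i))"
      unfolding \<xi>F re_sum by (simp add: r_def right_diff_distrib re_diff re_sum sum_subtractf)
    also have "\<dots> = q x0" by (simp only: sq q_def r_def norm_minus_commute)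
    finally show ?thesis .
  qed
  ultimately show False using tM D_le[OF x0(1)] by simp
qed

end

section \<open>Operators that are compact for a vector space topology\<close>

text \<open>
  What the norm topology and the weak topology have in common. Compact and weakly compact operators
  are treated together as the operators that map the ball to a relatively compact set for \<open>\<tau>\<close>.
\<close>

locale compatible_topology = normed_nspace Y
  for Y :: "('k::real_or_complex, 'w::ab_group_add) nspace" +
  fixes \<tau> :: "'w topology"
  assumes topspace: "topspace \<tau> = carrier Y"
    and hausdorff: "Hausdorff_space \<tau>"
    and continuous_add: "continuous_map (prod_topology \<tau> \<tau>) \<tau> (\<lambda>p. fst p + snd p)"
    and continuous_scl: "continuous_map (prod_topology euclidean \<tau>) \<tau> (\<lambda>p. scl Y (fst p) (snd p))"
    and continuous_op: "bounded_op Y Y S \<Longrightarrow> continuous_map \<tau> \<tau> S"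
    and continuous_functional: "bounded_op Y scalar_space g \<Longrightarrow> continuous_map \<tau> euclidean g"
begin

definition ball_compact ::
  "('k, 'v::ab_group_add) nspace \<Rightarrow> ('v \<Rightarrow> 'w) \<Rightarrow> bool" where
  "ball_compact A T \<longleftrightarrow> bounded_op A Y T \<and> compactin \<tau> (\<tau> closure_of (T ` unit_ball A))"

lemma ball_compactI:
  assumes "bounded_op A Y T" "compactin \<tau> K" "T ` unit_ball A \<subseteq> K"
  shows "ball_compact A T"
proof -
  have K: "closedin \<tau> K" by (rule compactin_imp_closedin[OF hausdorff assms(2)])
  then have "\<tau> closure_of (T ` unit_ball A) \<subseteq> K" using assms(3) by (intro closure_of_minimal)
  then show ?thesis
    unfolding ball_compact_def using assms(1,2) closed_compactin[OF assms(2)] by simp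
qed

lemma image_subset_closure:
  assumes "bounded_op A Y T" shows "T ` unit_ball A \<subseteq> \<tau> closure_of (T ` unit_ball A)"
  using assms by (intro closure_of_subset) (auto simp: topspace bounded_op_def unit_ball_def)

lemma ball_compact_add:
  assumes A: "normed_nspace A" and T: "ball_compact A T" "ball_compact A S"
  shows "ball_compact A (T + S)"
proof -
  interpret normed_pair A Y by (intro normed_pair.intro A normed_nspace_axioms)
  have b: "bounded_op A Y T" "bounded_op A Y S" using T by (auto simp: ball_compact_def)
  let ?K = "\<tau> closure_of (T ` unit_ball A)" and ?L = "\<tau> closure_of (S ` unit_ball A)"
  have "compactin (prod_topology \<tau> \<tau>) (?K \<times> ?L)"
    using T by (simp add: ball_compact_def compactin_Times)
  then have "compactin \<tau> ((\<lambda>p. fst p + snd p) ` (?K \<times> ?L))"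
    by (rule image_compactin[OF _ continuous_add])
  then show ?thesis
  proof (rule ball_compactI[OF bounded_op_add[OF b]])
    show "(T + S) ` unit_ball A \<subseteq> (\<lambda>p. fst p + snd p) ` (?K \<times> ?L)"
      using image_subset_closure[OF b(1)] image_subset_closure[OF b(2)] by force
  qed
qed

lemma ball_compact_left_comp:
  assumes A: "normed_nspace A" and T: "ball_compact A T" and S: "bounded_op Y Y S"
  shows "ball_compact A (S \<circ> T)"
proof -
  have b: "bounded_op A Y T" using T by (simp add: ball_compact_def)
  show ?thesis
  proof (rule ball_compactI)
    show "bounded_op A Y (S \<circ> T)"
      by (rule bounded_op_comp[OF A normed_nspace_axioms normed_nspace_axioms b S])
    show "compactin \<tau> (S ` (\<tau> closure_of (T ` unit_ball A)))"
      using T by (intro image_compactin[OF _ continuous_op[OF S]]) (simp add: ball_compact_def)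
    show "(S \<circ> T) ` unit_ball A \<subseteq> S ` (\<tau> closure_of (T ` unit_ball A))"
      using image_subset_closure[OF b] by (auto simp: image_comp[symmetric])
  qed
qed

lemma ball_compact_scl:
  assumes A: "normed_nspace A" and T: "ball_compact A T"
  shows "ball_compact A (\<lambda>x. scl Y c (T x))"
proof -
  interpret normed_pair A Y by (intro normed_pair.intro A normed_nspace_axioms)
  have b: "bounded_op A Y T" using T by (simp add: ball_compact_def)
  let ?K = "\<tau> closure_of (T ` unit_ball A)"
  have "compactin (prod_topology euclidean \<tau>) ({c} \<times> ?K)"
    using T by (simp add: ball_compact_def compactin_Times)
  then have "compactin \<tau> ((\<lambda>p. scl Y (fst p) (snd p)) ` ({c} \<times> ?K))"
    by (rule image_compactin[OF _ continuous_scl])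
  then show ?thesis
    by (rule ball_compactI[OF bounded_op_scl[OF b]]) (use image_subset_closure[OF b] in force)
qed

lemma ball_compact_rank_one:
  assumes A: "normed_nspace A" and b: "bounded_op A Y (\<lambda>a. scl Y (\<phi> a) y)"
    and \<phi>: "\<And>a. a \<in> unit_ball A \<Longrightarrow> norm (\<phi> a) \<le> 1" and y: "y \<in> carrier Y"
  shows "ball_compact A (\<lambda>a. scl Y (\<phi> a) y)"
proof -
  have "compactin (prod_topology euclidean \<tau>) (cball (0::'k) 1 \<times> {y})"
    using compact_scalar_cball y by (simp add: compactin_Times topspace)
  then have "compactin \<tau> ((\<lambda>p. scl Y (fst p) (snd p)) ` (cball (0::'k) 1 \<times> {y}))"
    by (rule image_compactin[OF _ continuous_scl])
  then show ?thesis
  proof (rule ball_compactI[OF b])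
    show "(\<lambda>a. scl Y (\<phi> a) y) ` unit_ball A \<subseteq> (\<lambda>p. scl Y (fst p) (snd p)) ` (cball 0 1 \<times> {y})"
      using \<phi> by force
  qed
qed

text \<open>
  For a compact \<open>T\<close> the second adjoint takes values in \<open>Y\<close>: by Goldstine's theorem every finite set
  of conditions \<open>g y = \<xi> (g \<circ> T)\<close> is approximately met on the image of the ball, and
  compactness makes all of them hold exactly at one point.
\<close>

lemma second_adjoint_value:
  assumes A: "normed_nspace A" and T: "ball_compact A T" and \<xi>: "\<xi> \<in> unit_ball (dual (dual A))"
  shows "\<exists>y\<in>\<tau> closure_of (T ` unit_ball A). \<forall>g. bounded_op Y scalar_space g \<longrightarrow> g y = \<xi> (g \<circ> T)"
proof -
  interpret A: normed_nspace A by fact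
  have b: "bounded_op A Y T" and K: "compactin \<tau> (\<tau> closure_of (T ` unit_ball A))"
    using T by (auto simp: ball_compact_def)
  let ?K = "\<tau> closure_of (T ` unit_ball A)"
  define C where "C = (\<lambda>(g, e). {y \<in> carrier Y. norm (g y - \<xi> (g \<circ> T)) \<le> e})"
  define P where "P = {(g, e). bounded_op Y scalar_space g \<and> (0::real) < e}"
  have gT: "bounded_op A scalar_space (g \<circ> T)" if "bounded_op Y scalar_space g" for g
    by (rule bounded_op_comp[OF A normed_nspace_axioms normed_scalar_space b that])
  have "?K \<inter> \<Inter> (C ` P) \<noteq> {}"
  proof (rule compactin_fip[THEN iffD1, OF K, THEN conjunct2, rule_format], intro conjI ballI allI impI)
    fix D assume "D \<in> C ` P"
    then obtain g e where g: "bounded_op Y scalar_space g" and D: "D = C (g, e)" by (auto simp: P_def)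
    have "closedin \<tau> {y \<in> topspace \<tau>. g y \<in> cball (\<xi> (g \<circ> T)) e}"
      by (rule closedin_continuous_map_preimage[OF continuous_functional[OF g]]) simp
    then show "closedin \<tau> D"
      by (simp add: D C_def topspace dist_norm norm_minus_commute)
  next
    fix \<F> assume "finite \<F> \<and> \<F> \<subseteq> C ` P"
    then obtain Q where Q: "Q \<subseteq> P" "finite Q" "\<F> = C ` Q" using finite_subset_image by metis
    define e where "e = Min (insert 1 (snd ` Q))"
    have e: "0 < e" "\<And>g d. (g, d) \<in> Q \<Longrightarrow> e \<le> d"
      using Q by (auto simp: e_def P_def intro!: Min_le image_eqI)
    have "bounded_op A scalar_space (fst p \<circ> T)" if "p \<in> Q" for p
      using gT Q(1) that by (auto simp: P_def)
    then obtain x where x: "x \<in> unit_ball A" "\<forall>p\<in>Q. norm ((fst p \<circ> T) x - \<xi> (fst p \<circ> T)) < e"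
      using A.goldstine[OF \<xi> Q(2), of "\<lambda>p. fst p \<circ> T" e] e(1) by blast
    have "T x \<in> ?K" using image_subset_closure[OF b] x(1) by blast
    moreover have "T x \<in> C p" if "p \<in> Q" for p
      using x(2) that e(2)[of "fst p" "snd p"] b x(1)
      by (fastforce simp: C_def case_prod_beta bounded_op_def unit_ball_def)
    ultimately show "?K \<inter> \<Inter> \<F> \<noteq> {}" using Q(3) by blast
  qed
  then obtain y where y: "y \<in> ?K" "\<And>p. p \<in> P \<Longrightarrow> y \<in> C p" by blast
  have "g y = \<xi> (g \<circ> T)" if g: "bounded_op Y scalar_space g" for g
  proof -
    have "norm (g y - \<xi> (g \<circ> T)) \<le> e" if "0 < e" for e
      using y(2)[of "(g, e)"] g that by (auto simp: P_def C_def)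
    then have "norm (g y - \<xi> (g \<circ> T)) \<le> 0" by (rule field_le_epsilon) simp
    then show ?thesis by simp
  qed
  with y(1) show ?thesis by blast
qed

end

lemma metric_norm_dist: "normed_nspace Y \<Longrightarrow> Metric_space (carrier Y) (norm_dist Y)"
proof -
  assume "normed_nspace Y"
  then interpret normed_nspace Y .
  show ?thesis
  proof
    fix x y show "0 \<le> norm_dist Y x y" by (simp add: norm_dist_def nrm_nonneg)
    show "norm_dist Y x y = norm_dist Y y x" by (simp add: norm_dist_def nrm_diff_commute)
    show "norm_dist Y x y = 0 \<longleftrightarrow> x = y" if "x \<in> carrier Y" "y \<in> carrier Y"
      using that by (simp add: norm_dist_def nrm_eq_0)
    fix z assume "x \<in> carrier Y" "y \<in> carrier Y" "z \<in> carrier Y"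
    then show "norm_dist Y x z \<le> norm_dist Y x y + norm_dist Y y z"
      using nrm_triangle[of "x - y" "y - z"] by (simp add: norm_dist_def)
  qed
qed

lemma compatible_norm_topology:
  assumes "normed_nspace Y" shows "compatible_topology Y (norm_topology Y)"
proof -
  interpret normed_nspace Y by fact
  interpret M: Metric_space "carrier Y" "norm_dist Y" by (rule metric_norm_dist[OF assms])
  have nt: "norm_topology Y = M.mtopology" by (simp add: norm_topology_def)
  have ball: "y \<in> M.mball x r \<longleftrightarrow> x \<in> carrier Y \<and> y \<in> carrier Y \<and> nrm Y (x - y) < r" for x y r
    by (auto simp: M.mball_def norm_dist_def)
  have cont: "continuous_map M.mtopology M.mtopology S" if S: "bounded_op Y Y S" for S
    unfolding M.continuous_map_from_metric
  proof (intro conjI ballI allI impI)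
    show "S \<in> carrier Y \<rightarrow> topspace M.mtopology" using E.op_mem[OF S] by simp
    fix a U assume a: "a \<in> carrier Y" and U: "openin M.mtopology U \<and> S a \<in> U"
    obtain e where e: "0 < e" "M.mball (S a) e \<subseteq> U" using U M.openin_mtopology by blast
    let ?n = "nrm (op_space Y Y) S + 1"
    have n: "0 < ?n" using E.op_nrm_nonneg[OF S] by simp
    have "S x \<in> U" if x: "x \<in> carrier Y" "norm_dist Y a x < e / ?n" for x
    proof -
      have "nrm Y (S a - S x) \<le> nrm (op_space Y Y) S * nrm Y (a - x)"
        using E.op_le[OF S, of "a - x"] E.op_diff[OF S a x(1)] a x by simp
      also have "\<dots> \<le> ?n * nrm Y (a - x)"
        using nrm_nonneg[of "a - x"] a x by (simp add: mult_right_mono)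
      also have "\<dots> < e" using x a n by (simp add: norm_dist_def field_simps)
      finally show ?thesis using e(2) ball E.op_mem[OF S] a x by blast
    qed
    then show "\<exists>r>0. \<forall>x. x \<in> carrier Y \<and> norm_dist Y a x < r \<longrightarrow> S x \<in> U"
      using e(1) n by (intro exI[of _ "e / ?n"]) auto
  qed
  have fnl: "continuous_map M.mtopology euclidean g" if g: "bounded_op Y scalar_space g" for g
    unfolding M.continuous_map_from_metric
  proof (intro conjI ballI allI impI)
    fix a U assume a: "a \<in> carrier Y" and U: "openin euclidean U \<and> g a \<in> U"
    then obtain e where e: "0 < e" "ball (g a) e \<subseteq> U" using open_contains_ball by (metis open_openin)
    let ?n = "nrm (dual Y) g + 1"
    have n: "0 < ?n" using D.op_nrm_nonneg[OF g] by (simp add: dual_def)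
    have "g x \<in> U" if x: "x \<in> carrier Y" "norm_dist Y a x < e / ?n" for x
    proof -
      have "norm (g a - g x) \<le> nrm (dual Y) g * nrm Y (a - x)"
        using dual_le[OF g, of "a - x"] D.op_diff[OF g a x(1)] a x by simp
      also have "\<dots> \<le> ?n * nrm Y (a - x)"
        using nrm_nonneg[of "a - x"] a x by (simp add: mult_right_mono)
      also have "\<dots> < e" using x a n by (simp add: norm_dist_def field_simps)
      finally show ?thesis using e(2) by (auto simp: dist_norm)
    qed
    then show "\<exists>r>0. \<forall>x. x \<in> carrier Y \<and> norm_dist Y a x < r \<longrightarrow> g x \<in> U"
      using e(1) n by (intro exI[of _ "e / ?n"]) auto
  qed simp
  have add: "continuous_map (prod_topology M.mtopology M.mtopology) M.mtopology (\<lambda>p. fst p + snd p)"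
    unfolding continuous_map_def
  proof (intro conjI allI impI)
    fix U assume U: "openin M.mtopology U"
    show "openin (prod_topology M.mtopology M.mtopology)
      {p \<in> topspace (prod_topology M.mtopology M.mtopology). fst p + snd p \<in> U}"
      unfolding openin_prod_topology_alt
    proof (intro allI impI)
      fix x y assume "(x, y) \<in> {p \<in> topspace (prod_topology M.mtopology M.mtopology). fst p + snd p \<in> U}"
      then have xy: "x \<in> carrier Y" "y \<in> carrier Y" "x + y \<in> U" by auto
      then obtain e where e: "0 < e" "M.mball (x + y) e \<subseteq> U" using U M.openin_mtopology by blast
      have "x' + y' \<in> U" if "x' \<in> M.mball x (e/2)" "y' \<in> M.mball y (e/2)" for x' y'
      proof -
        have m: "x' \<in> carrier Y" "y' \<in> carrier Y" "nrm Y (x - x') < e/2" "nrm Y (y - y') < e/2"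
          using that unfolding ball by auto
        have "nrm Y ((x + y) - (x' + y')) \<le> nrm Y (x - x') + nrm Y (y - y')"
          using nrm_triangle[of "x - x'" "y - y'"] xy m by (simp add: algebra_simps)
        then show ?thesis using e(2) m xy ball[of "x' + y'" "x + y" e] by auto
      qed
      then show "\<exists>V W. openin M.mtopology V \<and> openin M.mtopology W \<and> x \<in> V \<and> y \<in> W \<and>
        V \<times> W \<subseteq> {p \<in> topspace (prod_topology M.mtopology M.mtopology). fst p + snd p \<in> U}"
        using xy e(1) by (intro exI[of _ "M.mball x (e/2)"] exI[of _ "M.mball y (e/2)"]) (auto simp: ball)
    qed
  qed auto
  have scl: "continuous_map (prod_topology euclidean M.mtopology) M.mtopology (\<lambda>p. scl Y (fst p) (snd p))"
    unfolding continuous_map_def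
  proof (intro conjI allI impI)
    fix U assume U: "openin M.mtopology U"
    show "openin (prod_topology euclidean M.mtopology)
      {p \<in> topspace (prod_topology euclidean M.mtopology). scl Y (fst p) (snd p) \<in> U}"
      unfolding openin_prod_topology_alt
    proof (intro allI impI)
      fix c y assume "(c, y) \<in> {p \<in> topspace (prod_topology euclidean M.mtopology). scl Y (fst p) (snd p) \<in> U}"
      then have cy: "y \<in> carrier Y" "scl Y c y \<in> U" by auto
      then obtain e where e: "0 < e" "M.mball (scl Y c y) e \<subseteq> U" using U M.openin_mtopology by blast
      \<comment> \<open>\<open>r\<close> and \<open>s\<close> give each summand of \<open>(c - d) y + d (y - z)\<close> a norm of at most \<open>e / 2\<close>.\<close>
      define r where "r = e / (2 * (nrm Y y + 1))"
      define s where "s = e / (2 * (norm c + r + 1))"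
      have pos: "0 < nrm Y y + 1" "0 < r" using nrm_nonneg[OF cy(1)] e by (auto simp: r_def)
      have pos2: "0 < norm c + r + 1" "0 < s"
        using pos e by (auto simp: s_def add_nonneg_pos intro!: add_pos_pos divide_pos_pos)
      have "scl Y d z \<in> U" if "d \<in> ball c r" "z \<in> M.mball y s" for d z
      proof -
        have z: "z \<in> carrier Y" "nrm Y (y - z) < s" and d: "norm (c - d) < r"
          using that unfolding ball by (auto simp: dist_norm)
        have nd: "norm d \<le> norm c + r + 1" using norm_triangle_sub[of d c] d by (simp add: norm_minus_commute)
        have "scl Y c y - scl Y d z = scl Y (c - d) y + scl Y d (y - z)"
          by (simp add: VS.scale_left_diff_distrib VS.scale_right_diff_distrib)
        then have "nrm Y (scl Y c y - scl Y d z) \<le> nrm Y (scl Y (c - d) y) + nrm Y (scl Y d (y - z))"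
          using nrm_triangle[of "scl Y (c - d) y" "scl Y d (y - z)"] cy z by simp
        also have "\<dots> = norm (c - d) * nrm Y y + norm d * nrm Y (y - z)"
          using cy z by (simp add: nrm_scl)
        also have "\<dots> \<le> r * nrm Y y + (norm c + r + 1) * nrm Y (y - z)"
          using d nd nrm_nonneg cy z by (intro add_mono mult_right_mono) auto
        also have "\<dots> < r * (nrm Y y + 1) + (norm c + r + 1) * s"
          using pos pos2 z by (intro add_strict_mono mult_strict_left_mono) auto
        also have "r * (nrm Y y + 1) = e / 2" using pos unfolding r_def by (simp add: field_simps)
        also have "(norm c + r + 1) * s = e / 2" using pos2 unfolding s_def by (simp add: field_simps)
        finally show ?thesis using e(2) cy z ball[of "scl Y d z" "scl Y c y" e] by auto
      qed
      then show "\<exists>V W. openin euclidean V \<and> openin M.mtopology W \<and> c \<in> V \<and> y \<in> W \<and>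
        V \<times> W \<subseteq> {p \<in> topspace (prod_topology euclidean M.mtopology). scl Y (fst p) (snd p) \<in> U}"
        using cy pos pos2 by (intro exI[of _ "ball c r"] exI[of _ "M.mball y s"]) (auto simp: ball)
    qed
  qed auto
  show ?thesis
    unfolding nt by unfold_locales (use M.Hausdorff_space_mtopology add scl cont fnl in auto)
qed

lemma continuous_map_times:
  fixes f :: "'a \<Rightarrow> 'b::real_normed_algebra"
  shows "continuous_map \<sigma> euclidean f \<Longrightarrow> continuous_map \<sigma> euclidean g \<Longrightarrow>
    continuous_map \<sigma> euclidean (\<lambda>x. f x * g x)"
  by (simp add: continuous_map_atin tendsto_mult)

lemma topspace_weak_topology:
  assumes "normed_nspace Y" shows "topspace (weak_topology Y) = carrier Y"
proof -
  interpret normed_nspace Y by fact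
  have "carrier Y = {x \<in> carrier Y. (0 :: 'b \<Rightarrow> 'a) x \<in> UNIV}" by simp
  then have "carrier Y \<in> {{x \<in> carrier Y. f x \<in> U} | f U. f \<in> carrier (dual Y) \<and> open U}"
    using D.bounded_op_0 open_UNIV dual_simps(1) by blast
  then show ?thesis unfolding weak_topology_def topology_generated_by_topspace by blast
qed

lemma continuous_map_weak_topology_iff:
  fixes Y :: "('k::real_or_complex, 'w::ab_group_add) nspace"
  assumes "normed_nspace Y"
  shows "continuous_map \<sigma> (weak_topology Y) h \<longleftrightarrow> h ` topspace \<sigma> \<subseteq> carrier Y \<and>
    (\<forall>g. bounded_op Y scalar_space g \<longrightarrow> continuous_map \<sigma> euclidean (\<lambda>x. g (h x)))"
    (is "_ \<longleftrightarrow> ?R")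
proof -
  interpret normed_nspace Y by fact
  let ?S = "{{x \<in> carrier Y. f x \<in> U} | f U. f \<in> carrier (dual Y) \<and> open U}"
  have US: "\<Union> ?S = carrier Y"
    using topspace_weak_topology[OF assms] unfolding weak_topology_def topology_generated_by_topspace .
  have eq: "h -` {x \<in> carrier Y. g x \<in> U} \<inter> topspace \<sigma> = {x \<in> topspace \<sigma>. g (h x) \<in> U}"
    if "h ` topspace \<sigma> \<subseteq> carrier Y" for g :: "'w \<Rightarrow> 'k" and U using that by auto
  show ?thesis
    unfolding weak_topology_def continuous_on_generated_topo_iff US
  proof (intro iffI conjI allI impI; elim conjE)
    assume h: "\<forall>U. U \<in> ?S \<longrightarrow> openin \<sigma> (h -` U \<inter> topspace \<sigma>)" "h ` topspace \<sigma> \<subseteq> carrier Y"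
    then show "h ` topspace \<sigma> \<subseteq> carrier Y" by simp
    fix g assume g: "bounded_op Y scalar_space g"
    show "continuous_map \<sigma> euclidean (\<lambda>x. g (h x))"
      unfolding continuous_map_def
    proof (intro conjI allI impI)
      fix U :: "'k set" assume "openin euclidean U"
      then have "{x \<in> carrier Y. g x \<in> U} \<in> ?S" using g by auto
      then have "openin \<sigma> (h -` {x \<in> carrier Y. g x \<in> U} \<inter> topspace \<sigma>)" using h(1) by blast
      then show "openin \<sigma> {x \<in> topspace \<sigma>. g (h x) \<in> U}" by (simp only: eq[OF h(2)])
    qed auto
  next
    fix U assume h: "h ` topspace \<sigma> \<subseteq> carrier Y"
      "\<forall>g. bounded_op Y scalar_space g \<longrightarrow> continuous_map \<sigma> euclidean (\<lambda>x. g (h x))"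
    assume "U \<in> ?S"
    then obtain g V where g: "bounded_op Y scalar_space g" "open V" "U = {x \<in> carrier Y. g x \<in> V}" by auto
    then have "openin \<sigma> {x \<in> topspace \<sigma>. g (h x) \<in> V}"
      using openin_continuous_map_preimage[OF h(2)[rule_format, OF g(1)], of V] by simp
    then show "openin \<sigma> (h -` U \<inter> topspace \<sigma>)" using eq[OF h(1)] g(3) by simp
  qed
qed

text \<open>
  A map into the weak topology is continuous as soon as its compositions with the functionals are, which reduces
  the continuity of the operations to that of the operations on scalars. The Hausdorff property
  comes from the Hahn--Banach theorem.
\<close>

lemma compatible_weak_topology:
  assumes "normed_nspace Y" shows "compatible_topology Y (weak_topology Y)"
proof -
  interpret normed_nspace Y by fact
  let ?w = "weak_topology Y"
  have top: "topspace ?w = carrier Y" by (rule topspace_weak_topology[OF assms])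
  note iff = continuous_map_weak_topology_iff[OF assms]
  have fnl: "continuous_map ?w euclidean g" if "bounded_op Y scalar_space g" for g
    using iff[of ?w "\<lambda>x. x"] that by (simp add: continuous_map_id[unfolded id_def])
  show ?thesis
  proof
    show "topspace ?w = carrier Y" by (rule top)
    show "Hausdorff_space ?w"
      unfolding Hausdorff_space_def
    proof (intro allI impI, elim conjE)
      fix x y assume xy: "x \<in> topspace ?w" "y \<in> topspace ?w" "x \<noteq> y"
      then obtain g where g: "bounded_op Y scalar_space g" "g x \<noteq> g y"
        using functionals_separate[of x y] unfolding top by blast
      then obtain U V where UV: "open U" "open V" "g x \<in> U" "g y \<in> V" "U \<inter> V = {}"
        using Topological_Spaces.hausdorff[OF g(2)] by blast
      have "openin ?w {z \<in> topspace ?w. g z \<in> U}" "openin ?w {z \<in> topspace ?w. g z \<in> V}"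
        using openin_continuous_map_preimage[OF fnl[OF g(1)]] UV by auto
      then show "\<exists>U V. openin ?w U \<and> openin ?w V \<and> x \<in> U \<and> y \<in> V \<and> disjnt U V"
        using UV xy by (intro exI[of _ "{z \<in> topspace ?w. g z \<in> U}"] exI[of _ "{z \<in> topspace ?w. g z \<in> V}"])
          (auto simp: disjnt_def)
    qed
    show "continuous_map (prod_topology ?w ?w) ?w (\<lambda>p. fst p + snd p)"
      unfolding iff
    proof (intro conjI allI impI)
      fix g assume g: "bounded_op Y scalar_space g"
      have "continuous_map (prod_topology ?w ?w) euclidean (\<lambda>p. g (fst p) + g (snd p))"
        by (intro continuous_map_add continuous_map_compose[OF continuous_map_fst fnl[OF g], unfolded comp_def]
          continuous_map_compose[OF continuous_map_snd fnl[OF g], unfolded comp_def])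
      then show "continuous_map (prod_topology ?w ?w) euclidean (\<lambda>p. g (fst p + snd p))"
        by (rule continuous_map_eq) (auto simp: top D.op_add[OF g])
    qed (auto simp: top)
    show "continuous_map (prod_topology euclidean ?w) ?w (\<lambda>p. scl Y (fst p) (snd p))"
      unfolding iff
    proof (intro conjI allI impI)
      fix g assume g: "bounded_op Y scalar_space g"
      have "continuous_map (prod_topology euclidean ?w) euclidean (\<lambda>p. fst p * g (snd p))"
        by (intro continuous_map_times continuous_map_fst
          continuous_map_compose[OF continuous_map_snd fnl[OF g], unfolded comp_def])
      then show "continuous_map (prod_topology euclidean ?w) euclidean (\<lambda>p. g (scl Y (fst p) (snd p)))"
        by (rule continuous_map_eq) (auto simp: top D.op_scl[OF g])
    qed (auto simp: top)
    show "continuous_map ?w ?w S" if S: "bounded_op Y Y S" for S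
      unfolding iff
    proof (intro conjI allI impI)
      fix g assume g: "bounded_op Y scalar_space g"
      show "continuous_map ?w euclidean (\<lambda>x. g (S x))"
        using fnl[OF bounded_op_comp[OF assms assms normed_scalar_space S g]] by (simp add: comp_def)
    qed (use E.op_mem[OF S] top in auto)
  qed (rule fnl)
qed

section \<open>Rank-one operators\<close>

context normed_pair
begin

lemma bounded_op_rank_one:
  assumes \<phi>: "bounded_op A scalar_space \<phi>" and y: "y \<in> carrier Y"
  shows "bounded_op A Y (\<lambda>a. scl Y (\<phi> a) y)"
proof (rule bounded_opI[where C = "nrm (dual A) \<phi> * nrm Y y"])
  fix x assume x: "x \<in> carrier A"
  have "nrm Y (scl Y (\<phi> x) y) = norm (\<phi> x) * nrm Y y" using y by (rule Y.nrm_scl)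
  also have "\<dots> \<le> nrm (dual A) \<phi> * nrm A x * nrm Y y"
    using A.dual_le[OF \<phi> x] Y.nrm_nonneg[OF y] by (rule mult_right_mono)
  finally show "nrm Y (scl Y (\<phi> x) y) \<le> nrm (dual A) \<phi> * nrm Y y * nrm A x" by (simp add: ac_simps)
qed (use y in \<open>auto simp: A.D.op_add[OF \<phi>] A.D.op_scl[OF \<phi>] A.D.op_off[OF \<phi>] Y.VS.scale_left_distrib\<close>)

lemma nrm_rank_one:
  assumes \<phi>: "bounded_op A scalar_space \<phi>" and y: "y \<in> carrier Y"
  shows "nrm (op_space A Y) (\<lambda>a. scl Y (\<phi> a) y) = nrm (dual A) \<phi> * nrm Y y"
proof (rule antisym)
  let ?T = "\<lambda>a. scl Y (\<phi> a) y"
  have val: "nrm Y (?T x) = norm (\<phi> x) * nrm Y y" for x using y by (rule Y.nrm_scl)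
  have ball: "norm (\<phi> x) \<le> nrm (dual A) \<phi>" if "x \<in> unit_ball A" for x
    using A.D.op_ball_le[OF \<phi> that] by (simp add: dual_def)
  show "nrm (op_space A Y) ?T \<le> nrm (dual A) \<phi> * nrm Y y"
    using ball Y.nrm_nonneg[OF y] by (intro op_nrm_le_onI) (simp add: val mult_right_mono)
  show "nrm (dual A) \<phi> * nrm Y y \<le> nrm (op_space A Y) ?T"
  proof (cases "y = 0")
    case True
    then show ?thesis using op_nrm_nonneg[OF bounded_op_rank_one[OF \<phi> y]] by simp
  next
    case False
    then have pos: "0 < nrm Y y" using Y.nrm_nonneg[OF y] Y.nrm_eq_0[OF y] by simp
    have "nrm (dual A) \<phi> \<le> nrm (op_space A Y) ?T / nrm Y y"
      unfolding dual_def
    proof (rule A.D.op_nrm_le_onI)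
      fix x assume "x \<in> unit_ball A"
      from op_ball_le[OF bounded_op_rank_one[OF \<phi> y] this]
      show "nrm scalar_space (\<phi> x) \<le> nrm (op_space A Y) ?T / nrm Y y"
        using pos by (simp add: val field_simps)
    qed
    then show ?thesis using pos by (simp add: field_simps)
  qed
qed

lemma op_subspaceI:
  assumes "0 \<in> C" "\<And>T S. T \<in> C \<Longrightarrow> S \<in> C \<Longrightarrow> T + S \<in> C"
    and "\<And>c T. T \<in> C \<Longrightarrow> (\<lambda>x. scl Y c (T x)) \<in> C"
  shows "module.subspace (scl (op_space A Y)) C"
proof -
  interpret V: vector_space "scl (op_space A Y)" by (rule vector_space_op)
  show ?thesis unfolding V.subspace_def using assms by auto
qed

lemma normed_op_subspace:
  assumes "\<And>T. T \<in> C \<Longrightarrow> bounded_op A Y T" "module.subspace (scl (op_space A Y)) C"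
  shows "normed_nspace ((op_space A Y)\<lparr>carrier := C\<rparr>)"
  by (rule normed_nspace_subcarrier[OF normed_op_space]) (use assms in auto)

lemma nonzero_if_nrm_pos:
  assumes "T \<in> C" "0 < nrm (op_space A Y) T"
  shows "\<exists>T\<in>carrier ((op_space A Y)\<lparr>carrier := C\<rparr>). T \<noteq> 0"
  using assms normed_nspace.nrm_0[OF normed_op_space] by (intro bexI[of _ T]) auto

end

section \<open>Evaluation functionals and adjoints\<close>

text \<open>
  Outside the dual space the value is zero, as for every operator on the dual.
\<close>

definition evaluation :: "('k::real_or_complex, 'v::ab_group_add) nspace \<Rightarrow> 'v \<Rightarrow> ('v \<Rightarrow> 'k) \<Rightarrow> 'k" where
  "evaluation X x f = (if f \<in> carrier (dual X) then f x else 0)"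

definition dual_map ::
  "('k::real_or_complex, 'v::ab_group_add) nspace \<Rightarrow> ('v \<Rightarrow> 'v) \<Rightarrow> ('v \<Rightarrow> 'k) \<Rightarrow> 'v \<Rightarrow> 'k" where
  "dual_map X S f = (if f \<in> carrier (dual X) then f \<circ> S else 0)"

lemma (in normed_nspace) nonzero_dual:
  assumes "\<exists>x\<in>carrier X. x \<noteq> 0"
  shows "\<exists>f\<in>carrier (dual X). f \<noteq> 0"
proof -
  obtain x where "x \<in> unit_sphere X" using unit_sphere_exists[OF assms] by blast
  then obtain f where "f \<in> unit_sphere (dual X)" "f x = 1" using state_exists by blast
  then show ?thesis by (intro bexI[of _ f]) (auto simp: unit_sphere_def)
qed

text \<open>
  As a sublocale of the space itself, the dual would bring along all iterated duals; hence a locale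
  of its own.
\<close>

locale space_with_dual = normed_nspace X + dual: normed_nspace "dual X"
  for X :: "('k::real_or_complex, 'v::ab_group_add) nspace"
begin

lemma evaluation_apply [simp]: "bounded_op X scalar_space f \<Longrightarrow> evaluation X x f = f x"
  by (simp add: evaluation_def)

lemma bounded_op_evaluation:
  assumes x: "x \<in> carrier X"
  shows "bounded_op (dual X) scalar_space (evaluation X x)"
  by (rule dual.D.bounded_opI[where C = "nrm X x"])
    (use dual_le[OF _ x] D.bounded_op_add D.bounded_op_scl in \<open>auto simp: evaluation_def mult.commute\<close>)

lemma nrm_evaluation:
  assumes x: "x \<in> carrier X"
  shows "nrm (dual (dual X)) (evaluation X x) = nrm X x"
proof (rule antisym)
  note b = bounded_op_evaluation[OF x]
  show "nrm (dual (dual X)) (evaluation X x) \<le> nrm X x"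
    unfolding dual_def[of "dual X"]
    by (rule dual.D.op_nrm_leI) (use dual_le[OF _ x] x nrm_nonneg in \<open>auto simp: mult.commute\<close>)
  show "nrm X x \<le> nrm (dual (dual X)) (evaluation X x)"
  proof (rule nrm_le_if_functionals_le[OF x])
    show "0 \<le> nrm (dual (dual X)) (evaluation X x)"
      using dual.D.op_nrm_nonneg[OF b] by (simp add: dual_def)
    fix f assume f: "f \<in> unit_sphere (dual X)"
    then show "norm (f x) \<le> nrm (dual (dual X)) (evaluation X x)"
      using dual.dual_le[OF b, of f] by (simp add: unit_sphere_def)
  qed
qed

lemma dual_map_apply: "bounded_op X scalar_space f \<Longrightarrow> dual_map X S f = f \<circ> S"
  by (simp add: dual_map_def)

lemma functional_comp: "bounded_op X scalar_space f \<Longrightarrow> bounded_op X X S \<Longrightarrow> bounded_op X scalar_space (f \<circ> S)"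
  using bounded_op_comp[OF normed_nspace_axioms normed_nspace_axioms normed_scalar_space] by blast

lemma dual_map_combination_le:
  assumes f: "bounded_op X scalar_space f" and S: "bounded_op X X S" and "0 \<le> K"
    and le: "\<And>x. x \<in> carrier X \<Longrightarrow> nrm X (scl X d x + scl X c (S x)) \<le> K * nrm X x"
  shows "nrm (dual X) (\<lambda>x. d * f x + c * f (S x)) \<le> K * nrm (dual X) f"
  unfolding dual_def
proof (rule D.op_nrm_leI)
  have n: "0 \<le> nrm (op_space X scalar_space) f" by (rule D.op_nrm_nonneg[OF f])
  then show "0 \<le> K * nrm (op_space X scalar_space) f" using \<open>0 \<le> K\<close> by simp
  fix x assume x: "x \<in> carrier X"
  have Sx: "S x \<in> carrier X" by (rule E.op_mem[OF S x])
  have "d * f x + c * f (S x) = f (scl X d x + scl X c (S x))"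
    using x Sx by (simp add: D.op_add[OF f] D.op_scl[OF f])
  also have "norm \<dots> \<le> nrm (op_space X scalar_space) f * nrm X (scl X d x + scl X c (S x))"
    using D.op_le[OF f, of "scl X d x + scl X c (S x)"] x Sx by simp
  also have "\<dots> \<le> nrm (op_space X scalar_space) f * (K * nrm X x)"
    using le[OF x] n by (rule mult_left_mono)
  finally show "nrm scalar_space (d * f x + c * f (S x)) \<le> K * nrm (op_space X scalar_space) f * nrm X x"
    by (simp add: ac_simps)
qed

lemma nrm_dual_map_le:
  assumes f: "bounded_op X scalar_space f" and S: "bounded_op X X S"
  shows "nrm (dual X) (dual_map X S f) \<le> nrm (op_space X X) S * nrm (dual X) f"
  using dual_map_combination_le[OF f S E.op_nrm_nonneg[OF S], of 0 1] E.op_le[OF S]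
  by (simp add: dual_map_apply[OF f] comp_def)

lemma bounded_op_dual_map:
  assumes S: "bounded_op X X S" shows "bounded_op (dual X) (dual X) (dual_map X S)"
  by (rule dual.E.bounded_opI[where C = "nrm (op_space X X) S"])
    (use S nrm_dual_map_le[OF _ S] D.bounded_op_add D.bounded_op_scl functional_comp
     in \<open>auto simp: dual_map_def\<close>)

lemma dual_map_contraction:
  assumes S: "S \<in> unit_sphere (op_space X X)" and f: "f \<in> unit_ball (dual X)"
  shows "dual_map X S f \<in> unit_ball (dual X)"
  using nrm_dual_map_le[of f S] functional_comp[of f S] S f
  by (simp add: unit_ball_def unit_sphere_def dual_map_def)

end

lemma space_with_dual: "normed_nspace X \<Longrightarrow> space_with_dual X"
  by (intro space_with_dual.intro normed_nspace.normed_dual)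

section \<open>Comparison of an operator space with its codomain\<close>

text \<open>
  The operator induced by \<open>S\<close> is \<open>T \<mapsto> S \<circ> T\<close>. Its combinations with the identity are compositions
  with \<open>d I + c S\<close>, and on the rank-one operators \<open>\<phi> \<otimes> y\<close> it acts as \<open>S\<close> does on \<open>y\<close>.
\<close>

lemma numerical_index_le_codomain:
  assumes A: "normed_nspace A" and Y: "normed_nspace Y" "\<exists>y\<in>carrier Y. y \<noteq> 0"
    and C: "\<And>T. T \<in> C \<Longrightarrow> bounded_op A Y T" "module.subspace (scl (op_space A Y)) C"
    and \<phi>: "\<phi> \<in> unit_sphere (dual A)" "\<And>y. y \<in> carrier Y \<Longrightarrow> (\<lambda>a. scl Y (\<phi> a) y) \<in> C"
    and left: "\<And>S T. bounded_op Y Y S \<Longrightarrow> T \<in> C \<Longrightarrow> S \<circ> T \<in> C"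
  shows "numerical_index ((op_space A Y)\<lparr>carrier := C\<rparr>) \<le> numerical_index Y"
proof -
  interpret normed_pair A Y by (intro normed_pair.intro A Y)
  let ?Z = "(op_space A Y)\<lparr>carrier := C\<rparr>"
  have \<phi>b: "bounded_op A scalar_space \<phi>" and \<phi>1: "nrm (dual A) \<phi> = 1"
    using \<phi>(1) by (auto simp: unit_sphere_def)
  have Z: "normed_nspace ?Z" by (rule normed_op_subspace[OF C])
  obtain y0 where y0: "y0 \<in> unit_sphere Y" using Y.unit_sphere_exists[OF Y(2)] by blast
  then have Z0: "\<exists>z\<in>carrier ?Z. z \<noteq> 0"
    using nonzero_if_nrm_pos[OF \<phi>(2)[of y0]] nrm_rank_one[OF \<phi>b, of y0] \<phi>1
    by (simp add: unit_sphere_def)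
  show ?thesis
  proof (rule numerical_index_le_if_pencil_dominated[OF Y Z Z0])
    fix S assume "S \<in> unit_sphere (op_space Y Y)"
    then have S: "bounded_op Y Y S" by (simp add: unit_sphere_def)
    show "\<exists>P. (\<forall>z\<in>carrier ?Z. P z \<in> carrier ?Z) \<and>
      (\<forall>z\<in>carrier ?Z. \<forall>w\<in>carrier ?Z. P (z + w) = P z + P w) \<and>
      (\<forall>c. \<forall>z\<in>carrier ?Z. P (scl ?Z c z) = scl ?Z c (P z)) \<and> pencil_dominated Y S ?Z P \<and>
      (\<forall>a\<in>unit_ball Y. \<exists>z\<in>unit_ball ?Z. nrm Y (S a) \<le> nrm ?Z (P z))"
    proof (intro exI[of _ "\<lambda>T. S \<circ> T"] conjI ballI allI)
      fix T assume T: "T \<in> carrier ?Z"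
      then have TC: "T \<in> C" and Tb: "bounded_op A Y T" using C by auto
      show "S \<circ> T \<in> carrier ?Z" using left[OF S TC] by simp
      show "S \<circ> scl ?Z c T = scl ?Z c (S \<circ> T)" for c
        using op_mem'[OF Tb] by (auto simp: Y.E.op_scl[OF S])
      fix R assume "R \<in> carrier ?Z"
      then have "bounded_op A Y R" using C by auto
      then show "S \<circ> (T + R) = (S \<circ> T) + (S \<circ> R)"
        using op_mem'[OF Tb] op_mem' by (auto simp: Y.E.op_add[OF S])
    next
      show "pencil_dominated Y S ?Z (\<lambda>T. S \<circ> T)"
        unfolding pencil_dominated_def
      proof (intro allI impI ballI)
        fix d c K T assume K: "0 \<le> K"
          "\<forall>y\<in>carrier Y. nrm Y (scl Y d y + scl Y c (S y)) \<le> K * nrm Y y" and "T \<in> carrier ?Z"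
        then have T: "bounded_op A Y T" using C by auto
        have "nrm (op_space A Y) (\<lambda>x. scl Y d (T x) + scl Y c (S (T x))) \<le> K * nrm (op_space A Y) T"
        proof (rule op_nrm_le_onI)
          fix x assume x: "x \<in> unit_ball A"
          have "nrm Y (scl Y d (T x) + scl Y c (S (T x))) \<le> K * nrm Y (T x)"
            using K(2) op_mem'[OF T] by blast
          also have "\<dots> \<le> K * nrm (op_space A Y) T"
            using op_ball_le[OF T x] K(1) by (rule mult_left_mono)
          finally show "nrm Y (scl Y d (T x) + scl Y c (S (T x))) \<le> K * nrm (op_space A Y) T" .
        qed
        then show "nrm ?Z (scl ?Z d T + scl ?Z c (S \<circ> T)) \<le> K * nrm ?Z T"
          by (simp add: plus_fun_def)
      qed
    next
      fix a assume a: "a \<in> unit_ball Y"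
      then have ac: "a \<in> carrier Y" by (rule unit_ball_carrier)
      have Sa: "S a \<in> carrier Y" by (rule Y.E.op_mem[OF S ac])
      have "(\<lambda>x. scl Y (\<phi> x) a) \<in> unit_ball ?Z"
        using \<phi>(2)[OF ac] nrm_rank_one[OF \<phi>b ac] \<phi>1 a by (simp add: unit_ball_def)
      moreover have "S \<circ> (\<lambda>x. scl Y (\<phi> x) a) = (\<lambda>x. scl Y (\<phi> x) (S a))"
        using ac by (auto simp: Y.E.op_scl[OF S])
      moreover have "nrm ?Z (\<lambda>x. scl Y (\<phi> x) (S a)) = nrm Y (S a)"
        using nrm_rank_one[OF \<phi>b Sa] \<phi>1 by simp
      ultimately show "\<exists>z\<in>unit_ball ?Z. nrm Y (S a) \<le> nrm ?Z (S \<circ> z)"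
        by (intro bexI[of _ "\<lambda>x. scl Y (\<phi> x) a"]) auto
    qed
  qed
qed

section \<open>Comparison with the predual of the domain\<close>

text \<open>
  The operator induced by \<open>S\<close> is \<open>T \<mapsto> T \<circ> S\<^sup>*\<close>, which sends the rank-one operator of the evaluation
  at \<open>x\<close> to that of the evaluation at \<open>S x\<close>.
\<close>

lemma numerical_index_le_predual:
  assumes X: "normed_nspace X" "\<exists>x\<in>carrier X. x \<noteq> 0" and Y: "normed_nspace Y"
    and y0: "y0 \<in> unit_sphere Y"
    and C: "\<And>T. T \<in> C \<Longrightarrow> bounded_op (dual X) Y T" "module.subspace (scl (op_space (dual X) Y)) C"
    and eval: "\<And>x. x \<in> unit_ball X \<Longrightarrow> (\<lambda>f. scl Y (evaluation X x f) y0) \<in> C"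
    and right: "\<And>S T. S \<in> unit_sphere (op_space X X) \<Longrightarrow> T \<in> C \<Longrightarrow> T \<circ> dual_map X S \<in> C"
  shows "numerical_index ((op_space (dual X) Y)\<lparr>carrier := C\<rparr>) \<le> numerical_index X"
proof -
  interpret X: space_with_dual X by (rule space_with_dual[OF X(1)])
  interpret normed_pair "dual X" Y by (intro normed_pair.intro X.normed_dual Y)
  let ?Z = "(op_space (dual X) Y)\<lparr>carrier := C\<rparr>"
  have y0c: "y0 \<in> carrier Y" and y01: "nrm Y y0 = 1" using y0 by (auto simp: unit_sphere_def)
  have Z: "normed_nspace ?Z" by (rule normed_op_subspace[OF C])
  have nrm_eval: "nrm (op_space (dual X) Y) (\<lambda>f. scl Y (evaluation X x f) y0) = nrm X x"
    if x: "x \<in> carrier X" for x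
    using nrm_rank_one[OF X.bounded_op_evaluation[OF x] y0c] X.nrm_evaluation[OF x] y01 by simp
  obtain x0 where x0: "x0 \<in> unit_sphere X" using X.unit_sphere_exists[OF X(2)] by blast
  have Z0: "\<exists>z\<in>carrier ?Z. z \<noteq> 0"
    using nonzero_if_nrm_pos[OF eval[OF unit_sphere_subset[OF x0]]]
      nrm_eval[OF unit_sphere_carrier[OF x0]] x0 by (simp add: unit_sphere_def)
  show ?thesis
  proof (rule numerical_index_le_if_pencil_dominated[OF X Z Z0])
    fix S assume S1: "S \<in> unit_sphere (op_space X X)"
    then have S: "bounded_op X X S" by (simp add: unit_sphere_def)
    show "\<exists>P. (\<forall>z\<in>carrier ?Z. P z \<in> carrier ?Z) \<and>
      (\<forall>z\<in>carrier ?Z. \<forall>w\<in>carrier ?Z. P (z + w) = P z + P w) \<and>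
      (\<forall>c. \<forall>z\<in>carrier ?Z. P (scl ?Z c z) = scl ?Z c (P z)) \<and> pencil_dominated X S ?Z P \<and>
      (\<forall>a\<in>unit_ball X. \<exists>z\<in>unit_ball ?Z. nrm X (S a) \<le> nrm ?Z (P z))"
    proof (intro exI[of _ "\<lambda>T. T \<circ> dual_map X S"] conjI ballI allI)
      fix T assume T: "T \<in> carrier ?Z"
      show "T \<circ> dual_map X S \<in> carrier ?Z" using right[OF S1] T by simp
    next
      show "pencil_dominated X S ?Z (\<lambda>T. T \<circ> dual_map X S)"
        unfolding pencil_dominated_def
      proof (intro allI impI ballI)
        fix d c K T assume K: "0 \<le> K"
          "\<forall>x\<in>carrier X. nrm X (scl X d x + scl X c (S x)) \<le> K * nrm X x" and "T \<in> carrier ?Z"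
        then have T: "bounded_op (dual X) Y T" using C by auto
        have "nrm (op_space (dual X) Y) (\<lambda>f. scl Y d (T f) + scl Y c (T (dual_map X S f))) \<le>
          nrm (op_space (dual X) Y) T * K"
        proof (rule op_nrm_le_onI)
          fix f assume "f \<in> unit_ball (dual X)"
          then have f: "bounded_op X scalar_space f" "nrm (dual X) f \<le> 1" by (auto simp: unit_ball_def)
          let ?h = "scl (dual X) d f + scl (dual X) c (f \<circ> S)"
          have fc: "f \<in> carrier (dual X)" "f \<circ> S \<in> carrier (dual X)"
            using f X.functional_comp[OF f(1) S] by auto
          then have h: "?h \<in> carrier (dual X)" using X.dual.mem by blast
          have eq: "scl Y d (T f) + scl Y c (T (dual_map X S f)) = T ?h"
            using X.dual.mem(3)[OF fc(1), of d] X.dual.mem(3)[OF fc(2), of c]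
            by (simp only: op_add[OF T] op_scl[OF T fc(1)] op_scl[OF T fc(2)] X.dual_map_apply[OF f(1)])
          have "nrm (dual X) ?h \<le> K"
          proof -
            have "nrm (dual X) ?h \<le> K * nrm (dual X) f"
              using X.dual_map_combination_le[OF f(1) S K(1), of d c] K(2) by (simp add: plus_fun_def)
            also have "\<dots> \<le> K * 1" using f(2) K(1) by (rule mult_left_mono)
            finally show ?thesis by simp
          qed
          then have "nrm (op_space (dual X) Y) T * nrm (dual X) ?h \<le> nrm (op_space (dual X) Y) T * K"
            using op_nrm_nonneg[OF T] by (rule mult_left_mono)
          with op_le[OF T h]
          show "nrm Y (scl Y d (T f) + scl Y c (T (dual_map X S f))) \<le> nrm (op_space (dual X) Y) T * K"
            unfolding eq by (rule order_trans)
        qed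
        then show "nrm ?Z (scl ?Z d T + scl ?Z c (T \<circ> dual_map X S)) \<le> K * nrm ?Z T"
          by (simp add: plus_fun_def mult.commute)
      qed
    next
      fix a assume a: "a \<in> unit_ball X"
      then have ac: "a \<in> carrier X" by (rule unit_ball_carrier)
      have Sa: "S a \<in> carrier X" by (rule X.E.op_mem[OF S ac])
      let ?z = "\<lambda>f. scl Y (evaluation X a f) y0"
      have "?z \<in> unit_ball ?Z" using eval[OF a] nrm_eval[OF ac] a by (simp add: unit_ball_def)
      moreover have "evaluation X a (dual_map X S f) = evaluation X (S a) f" for f
        using X.functional_comp[OF _ S, of f] by (simp add: dual_map_def evaluation_def)
      then have "?z \<circ> dual_map X S = (\<lambda>f. scl Y (evaluation X (S a) f) y0)" by auto
      ultimately show "\<exists>z\<in>unit_ball ?Z. nrm X (S a) \<le> nrm ?Z (z \<circ> dual_map X S)"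
        using nrm_eval[OF Sa] by (intro bexI[of _ ?z]) auto
    qed (auto simp: plus_fun_def)
  qed
qed

section \<open>Comparison with the dual of the domain\<close>

text \<open>
  The operator induced by \<open>S\<close> sends \<open>T\<close> to the operator \<open>U\<close> whose adjoint is \<open>g \<mapsto> S (g \<circ> T)\<close>. Not
  every such map is an adjoint, so the existence of \<open>U\<close> is an assumption on the class \<open>C\<close>. The rank-one
  operator of a functional \<open>f\<close> goes to that of \<open>S f\<close>.
\<close>

lemma numerical_index_le_dual:
  assumes X: "normed_nspace X" "\<exists>x\<in>carrier X. x \<noteq> 0" and Y: "normed_nspace Y"
    and y0: "y0 \<in> unit_sphere Y"
    and C: "\<And>T. T \<in> C \<Longrightarrow> bounded_op X Y T" "module.subspace (scl (op_space X Y)) C"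
    and rank_one: "\<And>f. f \<in> unit_ball (dual X) \<Longrightarrow> (\<lambda>x. scl Y (f x) y0) \<in> C"
    and lift: "\<And>S T. S \<in> unit_sphere (op_space (dual X) (dual X)) \<Longrightarrow> T \<in> C \<Longrightarrow>
      \<exists>U\<in>C. \<forall>g x. bounded_op Y scalar_space g \<longrightarrow> x \<in> carrier X \<longrightarrow> g (U x) = S (g \<circ> T) x"
  shows "numerical_index ((op_space X Y)\<lparr>carrier := C\<rparr>) \<le> numerical_index (dual X)"
proof -
  interpret X: space_with_dual X by (rule space_with_dual[OF X(1)])
  interpret normed_pair X Y by (intro normed_pair.intro X Y)
  let ?Z = "(op_space X Y)\<lparr>carrier := C\<rparr>"
  have y0c: "y0 \<in> carrier Y" and y01: "nrm Y y0 = 1" using y0 by (auto simp: unit_sphere_def)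
  have Z: "normed_nspace ?Z" by (rule normed_op_subspace[OF C])
  have X0: "\<exists>f\<in>carrier (dual X). f \<noteq> 0" by (rule X.nonzero_dual[OF X(2)])
  obtain f0 where f0: "f0 \<in> unit_sphere (dual X)" using X.dual.unit_sphere_exists[OF X0] by blast
  have nrm_f: "nrm (op_space X Y) (\<lambda>x. scl Y (f x) y0) = nrm (dual X) f"
    if "bounded_op X scalar_space f" for f
    using nrm_rank_one[OF that y0c] y01 by simp
  have Z0: "\<exists>z\<in>carrier ?Z. z \<noteq> 0"
    using nonzero_if_nrm_pos[OF rank_one[OF unit_sphere_subset[OF f0]]] nrm_f[of f0] f0
    by (simp add: unit_sphere_def)
  show ?thesis
  proof (rule numerical_index_le_if_pencil_dominated[OF X.normed_dual X0 Z Z0])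
    fix S assume S1: "S \<in> unit_sphere (op_space (dual X) (dual X))"
    then have S: "bounded_op (dual X) (dual X) S" by (simp add: unit_sphere_def)
    have "\<forall>T\<in>C. \<exists>U. U \<in> C \<and>
        (\<forall>g x. bounded_op Y scalar_space g \<longrightarrow> x \<in> carrier X \<longrightarrow> g (U x) = S (g \<circ> T) x)"
      using lift[OF S1] by blast
    then obtain P where P_all: "\<forall>T\<in>C. P T \<in> C \<and>
        (\<forall>g x. bounded_op Y scalar_space g \<longrightarrow> x \<in> carrier X \<longrightarrow> g (P T x) = S (g \<circ> T) x)"
      unfolding bchoice_iff ..
    have P1: "P T \<in> C" if "T \<in> C" for T using P_all that by blast
    have P2: "g (P T x) = S (g \<circ> T) x"
      if "T \<in> C" "bounded_op Y scalar_space g" "x \<in> carrier X" for T g x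
      using P_all that by blast
    have gT: "g \<circ> T \<in> carrier (dual X)" if "bounded_op Y scalar_space g" "T \<in> C" for g T
      using bounded_op_comp[OF X(1) Y normed_scalar_space C(1)[OF that(2)] that(1)] by simp
    interpret Z: normed_nspace ?Z by (rule Z)
    \<comment> \<open>Functionals separate the points of \<open>Y\<close>, so the chosen \<open>P\<close> inherits linearity from \<open>S\<close>.\<close>
    have P_eqI: "P T = R" if T: "T \<in> C" and R: "bounded_op X Y R"
      and eq: "\<And>g x. bounded_op Y scalar_space g \<Longrightarrow> x \<in> carrier X \<Longrightarrow> S (g \<circ> T) x = g (R x)" for T R
    proof (rule op_ext[OF C(1)[OF P1[OF T]] R])
      fix x assume x: "x \<in> carrier X"
      show "P T x = R x"
      proof (rule Y.functionals_separate)
        show "P T x \<in> carrier Y" "R x \<in> carrier Y" using op_mem' C(1)[OF P1[OF T]] R by auto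
        show "g (P T x) = g (R x)" if "bounded_op Y scalar_space g" for g
          using P2[OF T that x] eq[OF that x] by simp
      qed
    qed
    show "\<exists>P. (\<forall>z\<in>carrier ?Z. P z \<in> carrier ?Z) \<and>
      (\<forall>z\<in>carrier ?Z. \<forall>w\<in>carrier ?Z. P (z + w) = P z + P w) \<and>
      (\<forall>c. \<forall>z\<in>carrier ?Z. P (scl ?Z c z) = scl ?Z c (P z)) \<and> pencil_dominated (dual X) S ?Z P \<and>
      (\<forall>a\<in>unit_ball (dual X). \<exists>z\<in>unit_ball ?Z. nrm (dual X) (S a) \<le> nrm ?Z (P z))"
    proof (intro exI[of _ P] conjI ballI allI)
      fix T assume "T \<in> carrier ?Z"
      then have T: "T \<in> C" by simp
      note Tb = C(1)[OF T] and PTb = C(1)[OF P1[OF T]]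
      show "P T \<in> carrier ?Z" using P1[OF T] by simp
      show "P (scl ?Z c T) = scl ?Z c (P T)" for c
      proof (rule P_eqI)
        show "scl ?Z c T \<in> C" using Z.mem(3)[of T c] T by simp
        show "bounded_op X Y (scl ?Z c (P T))" using bounded_op_scl[OF PTb] by simp
        fix g x assume g: "bounded_op Y scalar_space g" and x: "x \<in> carrier X"
        have "g \<circ> scl ?Z c T = scl (dual X) c (g \<circ> T)"
          using op_mem'[OF Tb] by (auto simp: Y.D.op_scl[OF g])
        then have "S (g \<circ> scl ?Z c T) x = c * S (g \<circ> T) x"
          using X.dual.E.op_scl[OF S gT[OF g T], of c] by simp
        also have "\<dots> = g (scl ?Z c (P T) x)"
          using P2[OF T g x] op_mem'[OF PTb] by (simp add: Y.D.op_scl[OF g])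
        finally show "S (g \<circ> scl ?Z c T) x = g (scl ?Z c (P T) x)" .
      qed
      fix R assume "R \<in> carrier ?Z"
      then have R: "R \<in> C" by simp
      note Rb = C(1)[OF R] and PRb = C(1)[OF P1[OF R]]
      show "P (T + R) = P T + P R"
      proof (rule P_eqI)
        show "T + R \<in> C" using Z.mem(2)[of T R] T R by simp
        show "bounded_op X Y (P T + P R)" by (rule bounded_op_add[OF PTb PRb])
        fix g x assume g: "bounded_op Y scalar_space g" and x: "x \<in> carrier X"
        have "g \<circ> (T + R) = (g \<circ> T) + (g \<circ> R)"
          using op_mem'[OF Tb] op_mem'[OF Rb] by (auto simp: Y.D.op_add[OF g])
        then have "S (g \<circ> (T + R)) x = S (g \<circ> T) x + S (g \<circ> R) x"
          using X.dual.E.op_add[OF S gT[OF g T] gT[OF g R]] by simp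
        also have "\<dots> = g ((P T + P R) x)"
          using P2[OF T g x] P2[OF R g x] op_mem'[OF PTb] op_mem'[OF PRb]
          by (simp add: Y.D.op_add[OF g])
        finally show "S (g \<circ> (T + R)) x = g ((P T + P R) x)" .
      qed
    next
      show "pencil_dominated (dual X) S ?Z P"
        unfolding pencil_dominated_def
      proof (intro allI impI ballI)
        fix d c K T assume K: "0 \<le> K" "\<forall>f\<in>carrier (dual X).
            nrm (dual X) (scl (dual X) d f + scl (dual X) c (S f)) \<le> K * nrm (dual X) f"
          and "T \<in> carrier ?Z"
        then have T: "T \<in> C" by simp
        note Tb = C(1)[OF T] and PTb = C(1)[OF P1[OF T]]
        have "nrm (op_space X Y) (\<lambda>x. scl Y d (T x) + scl Y c (P T x)) \<le> K * nrm (op_space X Y) T"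
        proof (rule op_nrm_le_onI)
          fix x assume x: "x \<in> unit_ball X"
          have xc: "x \<in> carrier X" using x by (rule unit_ball_carrier)
          have m: "T x \<in> carrier Y" "P T x \<in> carrier Y" using op_mem' Tb PTb by auto
          show "nrm Y (scl Y d (T x) + scl Y c (P T x)) \<le> K * nrm (op_space X Y) T"
          proof (rule Y.nrm_le_if_functionals_le)
            show "scl Y d (T x) + scl Y c (P T x) \<in> carrier Y" using m by simp
            show "0 \<le> K * nrm (op_space X Y) T" using K(1) op_nrm_nonneg[OF Tb] by simp
            fix g assume g1: "g \<in> unit_sphere (dual Y)"
            then have g: "bounded_op Y scalar_space g" by (simp add: unit_sphere_def)
            let ?h = "scl (dual X) d (g \<circ> T) + scl (dual X) c (S (g \<circ> T))"
            have hc: "?h \<in> carrier (dual X)"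
              using gT[OF g T] X.dual.E.op_mem[OF S gT[OF g T]] X.dual.mem by blast
            have eq: "g (scl Y d (T x) + scl Y c (P T x)) = ?h x"
              using m P2[OF T g xc] by (simp add: Y.D.op_add[OF g] Y.D.op_scl[OF g])
            have "norm (?h x) \<le> nrm (dual X) ?h"
              using X.D.op_ball_le[of ?h x] hc x by (simp add: dual_def)
            also have "\<dots> \<le> K * nrm (dual X) (g \<circ> T)" using K(2) gT[OF g T] by blast
            also have "\<dots> \<le> K * nrm (op_space X Y) T"
            proof (rule mult_left_mono[OF _ K(1)])
              show "nrm (dual X) (g \<circ> T) \<le> nrm (op_space X Y) T"
                unfolding dual_def
              proof (rule X.D.op_nrm_le_onI)
                fix u assume "u \<in> unit_ball X"
                then show "nrm scalar_space ((g \<circ> T) u) \<le> nrm (op_space X Y) T"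
                  using Y.dual_sphere_le[OF unit_sphere_subset[OF g1] op_mem'[OF Tb, of u]]
                    op_ball_le[OF Tb, of u] by simp
              qed
            qed
            finally show "norm (g (scl Y d (T x) + scl Y c (P T x))) \<le> K * nrm (op_space X Y) T"
              unfolding eq .
          qed
        qed
        then show "nrm ?Z (scl ?Z d T + scl ?Z c (P T)) \<le> K * nrm ?Z T" by (simp add: plus_fun_def)
      qed
    next
      fix f assume f1: "f \<in> unit_ball (dual X)"
      then have f: "bounded_op X scalar_space f" "f \<in> carrier (dual X)" by (auto simp: unit_ball_def)
      let ?z = "\<lambda>x. scl Y (f x) y0"
      have zC: "?z \<in> C" by (rule rank_one[OF f1])
      have zb: "?z \<in> unit_ball ?Z" using zC nrm_f[OF f(1)] f1 by (simp add: unit_ball_def)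
      obtain g where g1: "g \<in> unit_sphere (dual Y)" "g y0 = 1" by (rule Y.state_exists[OF y0])
      then have g: "bounded_op Y scalar_space g" by (simp add: unit_sphere_def)
      have gz: "g \<circ> ?z = f" using y0c g1(2) by (auto simp: Y.D.op_scl[OF g])
      note Pzb = C(1)[OF P1[OF zC]]
      have "nrm (dual X) (S f) \<le> nrm (op_space X Y) (P ?z)"
        unfolding dual_def
      proof (rule X.D.op_nrm_le_onI)
        fix x assume x: "x \<in> unit_ball X"
        have "S f x = g (P ?z x)" using P2[OF zC g unit_ball_carrier[OF x]] gz by simp
        moreover have "norm (g (P ?z x)) \<le> nrm Y (P ?z x)"
          by (rule Y.dual_sphere_le[OF unit_sphere_subset[OF g1(1)] op_mem'[OF Pzb]])
        moreover have "nrm Y (P ?z x) \<le> nrm (op_space X Y) (P ?z)" by (rule op_ball_le[OF Pzb x])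
        ultimately show "nrm scalar_space (S f x) \<le> nrm (op_space X Y) (P ?z)"
          unfolding dual_def by simp
      qed
      then show "\<exists>z\<in>unit_ball ?Z. nrm (dual X) (S f) \<le> nrm ?Z (P z)" using zb by (intro bexI) auto
    qed
  qed
qed

section \<open>Weak-star continuous operators\<close>

context space_with_dual
begin

lemma topspace_weak_star_topology: "topspace (weak_star_topology X) = carrier (dual X)"
proof -
  have "carrier (dual X) = {f \<in> carrier (dual X). f 0 \<in> UNIV}" by simp
  then have "carrier (dual X) \<in> {{f \<in> carrier (dual X). f x \<in> U} | x U. x \<in> carrier X \<and> open U}"
    using mem(1) open_UNIV by blast
  then show ?thesis unfolding weak_star_topology_def topology_generated_by_topspace by blast
qed

lemma continuous_map_evaluation:
  assumes x: "x \<in> carrier X"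
  shows "continuous_map (weak_star_topology X) euclidean (\<lambda>f. f x)"
  unfolding continuous_map_def topspace_weak_star_topology
proof (intro conjI allI impI)
  fix U :: "'k set" assume "openin euclidean U"
  then have "{f \<in> carrier (dual X). f x \<in> U} \<in>
      {{f \<in> carrier (dual X). f x \<in> U} | x U. x \<in> carrier X \<and> open U}" using x by auto
  then show "openin (weak_star_topology X) {f \<in> carrier (dual X). f x \<in> U}"
    unfolding weak_star_topology_def by (rule topology_generated_by_Basis)
qed simp

lemma continuous_map_dual_map:
  assumes S: "bounded_op X X S"
  shows "continuous_map (weak_star_topology X) (weak_star_topology X) (dual_map X S)"
proof -
  let ?w = "weak_star_topology X"
  let ?B = "{{f \<in> carrier (dual X). f x \<in> U} | x U. x \<in> carrier X \<and> open U}"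
  have B: "\<Union> ?B = carrier (dual X)"
    using topspace_weak_star_topology unfolding weak_star_topology_def topology_generated_by_topspace .
  have maps: "dual_map X S f \<in> carrier (dual X)" if "f \<in> carrier (dual X)" for f
    using functional_comp[OF _ S] that by (simp add: dual_map_def)
  have "openin ?w (dual_map X S -` V \<inter> topspace ?w)" if V: "V \<in> ?B" for V
  proof -
    obtain x U where x: "x \<in> carrier X" "open U" "V = {f \<in> carrier (dual X). f x \<in> U}" using V by blast
    have "openin ?w {f \<in> topspace ?w. f (S x) \<in> U}"
      using continuous_map_evaluation[OF E.op_mem[OF S x(1)]] x(2)
      by (intro openin_continuous_map_preimage) auto
    also have "{f \<in> topspace ?w. f (S x) \<in> U} = dual_map X S -` V \<inter> topspace ?w"
      using maps unfolding topspace_weak_star_topology x(3) by (auto simp: dual_map_def)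
    finally show ?thesis .
  qed
  then have "continuous_map ?w (topology_generated_by ?B) (dual_map X S)"
    unfolding continuous_on_generated_topo_iff B using maps by (auto simp: topspace_weak_star_topology)
  then show ?thesis unfolding weak_star_topology_def .
qed

end

text \<open>
  Bounded and compact operators are handled together, as a class \<open>P\<close> that is stable under the
  operations involved. Weak-star continuity is preserved because \<open>T \<circ> S\<^sup>*\<close> and \<open>g \<circ> S \<circ> T\<close> are
  compositions of continuous maps.
\<close>

lemma numerical_index_weak_star_continuous_le:
  assumes X: "normed_nspace X" "\<exists>x\<in>carrier X. x \<noteq> 0" and Y: "normed_nspace Y" "\<exists>y\<in>carrier Y. y \<noteq> 0"
    and P: "\<And>T. P T \<Longrightarrow> bounded_op (dual X) Y T"
    and add: "\<And>T S. P T \<Longrightarrow> P S \<Longrightarrow> P (T + S)"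
    and scl: "\<And>c T. P T \<Longrightarrow> P (\<lambda>f. scl Y c (T f))"
    and left: "\<And>S T. bounded_op Y Y S \<Longrightarrow> P T \<Longrightarrow> P (S \<circ> T)"
    and right: "\<And>S T. S \<in> unit_sphere (op_space X X) \<Longrightarrow> P T \<Longrightarrow> P (T \<circ> dual_map X S)"
    and rank_one: "\<And>x y. x \<in> unit_ball X \<Longrightarrow> y \<in> carrier Y \<Longrightarrow> P (\<lambda>f. scl Y (evaluation X x f) y)"
  defines "C \<equiv> {T. P T \<and> continuous_map (weak_star_topology X) (weak_topology Y) T}"
  shows "numerical_index ((op_space (dual X) Y)\<lparr>carrier := C\<rparr>) \<le> min (numerical_index X) (numerical_index Y)"
proof -
  interpret X: space_with_dual X by (rule space_with_dual[OF X(1)])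
  interpret normed_pair "dual X" Y by (intro normed_pair.intro X.normed_dual Y)
  let ?w = "weak_star_topology X"
  note iff = continuous_map_weak_topology_iff[OF Y(1)]
  have CI: "T \<in> C" if "P T" "\<And>g. bounded_op Y scalar_space g \<Longrightarrow> continuous_map ?w euclidean (\<lambda>f. g (T f))" for T
    using that op_mem'[OF P[OF that(1)]] unfolding C_def iff by auto
  have CD: "P T" "bounded_op (dual X) Y T"
    "bounded_op Y scalar_space g \<Longrightarrow> continuous_map ?w euclidean (\<lambda>f. g (T f))" if "T \<in> C" for T g
    using that P unfolding C_def iff by auto
  have rank_one_C: "(\<lambda>f. scl Y (evaluation X x f) y) \<in> C" if x: "x \<in> unit_ball X" and y: "y \<in> carrier Y" for x y
  proof (rule CI[OF rank_one[OF x y]])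
    fix g assume g: "bounded_op Y scalar_space g"
    have "continuous_map ?w euclidean (\<lambda>f. f x * g y)"
      using X.continuous_map_evaluation[OF unit_ball_carrier[OF x]]
      by (intro continuous_map_times) auto
    then show "continuous_map ?w euclidean (\<lambda>f. g (scl Y (evaluation X x f) y))"
      by (rule continuous_map_eq)
        (use y in \<open>auto simp: X.topspace_weak_star_topology Y.D.op_scl[OF g]\<close>)
  qed
  have "(\<lambda>f. scl Y (evaluation X 0 f) 0) \<in> C" by (rule rank_one_C) auto
  then have zero: "0 \<in> C" by (simp add: zero_fun_def)
  have sub: "module.subspace (scl (op_space (dual X) Y)) C"
  proof (rule op_subspaceI[OF zero])
    fix T S assume TS: "T \<in> C" "S \<in> C"
    show "T + S \<in> C"
    proof (rule CI)
      show "P (T + S)" using add CD(1) TS by blast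
      fix g assume g: "bounded_op Y scalar_space g"
      have "continuous_map ?w euclidean (\<lambda>f. g (T f) + g (S f))"
        using CD(3)[OF _ g] TS by (intro continuous_map_add)
      then show "continuous_map ?w euclidean (\<lambda>f. g ((T + S) f))"
        using op_mem'[OF CD(2)[OF TS(1)]] op_mem'[OF CD(2)[OF TS(2)]] by (simp add: Y.D.op_add[OF g])
    qed
  next
    fix c T assume T: "T \<in> C"
    show "(\<lambda>f. scl Y c (T f)) \<in> C"
    proof (rule CI)
      show "P (\<lambda>f. scl Y c (T f))" using scl CD(1) T by blast
      fix g assume g: "bounded_op Y scalar_space g"
      have "continuous_map ?w euclidean (\<lambda>f. c * g (T f))"
        using CD(3)[OF T g] by (intro continuous_map_times) auto
      then show "continuous_map ?w euclidean (\<lambda>f. g (scl Y c (T f)))"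
        using op_mem'[OF CD(2)[OF T]] by (simp add: Y.D.op_scl[OF g])
    qed
  qed
  obtain x0 where x0: "x0 \<in> unit_sphere X" using X.unit_sphere_exists[OF X(2)] by blast
  obtain y0 where y0: "y0 \<in> unit_sphere Y" using Y.unit_sphere_exists[OF Y(2)] by blast
  have "numerical_index ((op_space (dual X) Y)\<lparr>carrier := C\<rparr>) \<le> numerical_index Y"
  proof (rule numerical_index_le_codomain[OF X.normed_dual Y CD(2) sub])
    show "evaluation X x0 \<in> unit_sphere (dual (dual X))"
      using X.bounded_op_evaluation[of x0] X.nrm_evaluation[of x0] x0 by (simp add: unit_sphere_def X.dual.dual_simps)
    show "(\<lambda>f. scl Y (evaluation X x0 f) y) \<in> C" if "y \<in> carrier Y" for y
      using rank_one_C unit_sphere_subset[OF x0] that by blast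
    show "S \<circ> T \<in> C" if S: "bounded_op Y Y S" and T: "T \<in> C" for S T
    proof (rule CI)
      show "P (S \<circ> T)" using left[OF S] CD(1)[OF T] .
      fix g assume "bounded_op Y scalar_space g"
      then have "bounded_op Y scalar_space (g \<circ> S)"
        by (rule bounded_op_comp[OF Y(1) Y(1) normed_scalar_space S])
      from CD(3)[OF T this] show "continuous_map ?w euclidean (\<lambda>f. g ((S \<circ> T) f))" by simp
    qed
  qed
  moreover have "numerical_index ((op_space (dual X) Y)\<lparr>carrier := C\<rparr>) \<le> numerical_index X"
  proof (rule numerical_index_le_predual[OF X Y(1) y0 CD(2) sub])
    show "(\<lambda>f. scl Y (evaluation X x f) y0) \<in> C" if "x \<in> unit_ball X" for x
      using rank_one_C[OF that] unit_sphere_carrier[OF y0] .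
    show "T \<circ> dual_map X S \<in> C" if S: "S \<in> unit_sphere (op_space X X)" and T: "T \<in> C" for S T
      using right[OF S CD(1)[OF T]] T S X.continuous_map_dual_map[of S] continuous_map_compose
      unfolding C_def by (auto simp: unit_sphere_def)
  qed
  ultimately show ?thesis by simp
qed

section \<open>Compact and weakly compact operators\<close>

context compatible_topology
begin

lemma ball_compact_zero: "normed_nspace A \<Longrightarrow> ball_compact A 0"
proof -
  assume A: "normed_nspace A"
  then interpret normed_pair A Y by (intro normed_pair.intro normed_nspace_axioms)
  show ?thesis
    using ball_compact_rank_one[OF A, of "\<lambda>a. 0" 0] bounded_op_0 by (simp add: zero_fun_def)
qed

lemma ball_compact_subspace:
  assumes "normed_nspace A"
  shows "module.subspace (scl (op_space A Y)) {T. ball_compact A T}"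
proof -
  interpret normed_pair A Y by (intro normed_pair.intro assms normed_nspace_axioms)
  show ?thesis
    by (rule op_subspaceI) (auto simp: assms ball_compact_zero ball_compact_add ball_compact_scl)
qed

lemma ball_compact_right_comp:
  assumes T: "ball_compact A T" and b: "bounded_op B Y (T \<circ> R)"
    and R: "\<And>b. b \<in> unit_ball B \<Longrightarrow> R b \<in> unit_ball A"
  shows "ball_compact B (T \<circ> R)"
proof (rule ball_compactI[OF b])
  show "compactin \<tau> (\<tau> closure_of (T ` unit_ball A))" using T by (simp add: ball_compact_def)
  show "(T \<circ> R) ` unit_ball B \<subseteq> \<tau> closure_of (T ` unit_ball A)"
    using image_subset_closure[of A T] T R by (auto simp: ball_compact_def)
qed

text \<open>
  For \<open>S\<close> on the dual of \<open>A\<close>, the operator \<open>T\<^sup>*\<^sup>* \<circ> S\<^sup>* \<circ> J\<close> is again compact, with values in the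
  compact closure of the image of the ball under \<open>T\<close>; here \<open>J\<close> is the embedding in the bidual.
\<close>

lemma ball_compact_lift:
  assumes A: "normed_nspace A" and S: "S \<in> unit_sphere (op_space (dual A) (dual A))"
    and T: "ball_compact A T"
  shows "\<exists>U. ball_compact A U \<and>
    (\<forall>g x. bounded_op Y scalar_space g \<longrightarrow> x \<in> carrier A \<longrightarrow> g (U x) = S (g \<circ> T) x)"
proof -
  interpret A: space_with_dual A by (rule space_with_dual[OF A])
  interpret normed_pair A Y by (intro normed_pair.intro A normed_nspace_axioms)
  let ?K = "\<tau> closure_of (T ` unit_ball A)"
  have Tb: "bounded_op A Y T" and K: "compactin \<tau> ?K" using T by (auto simp: ball_compact_def)
  have Sb: "bounded_op (dual A) (dual A) S" using S by (simp add: unit_sphere_def)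
  have gT: "bounded_op A scalar_space (g \<circ> T)" if "bounded_op Y scalar_space g" for g
    by (rule bounded_op_comp[OF A normed_nspace_axioms normed_scalar_space Tb that])
  have ball: "\<exists>y\<in>?K. \<forall>g. bounded_op Y scalar_space g \<longrightarrow> g y = S (g \<circ> T) x" if x: "x \<in> unit_ball A" for x
  proof -
    let ?\<xi> = "dual_map (dual A) S (evaluation A x)"
    have ev: "bounded_op (dual A) scalar_space (evaluation A x)"
      by (rule A.bounded_op_evaluation[OF unit_ball_carrier[OF x]])
    then have "evaluation A x \<in> unit_ball (dual (dual A))"
      using x A.nrm_evaluation[of x] by (simp add: unit_ball_def A.dual.dual_simps)
    then have "?\<xi> \<in> unit_ball (dual (dual A))"
      by (rule space_with_dual.dual_map_contraction[OF space_with_dual[OF A.normed_dual] S])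
    then obtain y where y: "y \<in> ?K" "\<forall>g. bounded_op Y scalar_space g \<longrightarrow> g y = ?\<xi> (g \<circ> T)"
      using second_adjoint_value[OF A T] by blast
    have "?\<xi> (g \<circ> T) = S (g \<circ> T) x" if g: "bounded_op Y scalar_space g" for g
    proof -
      have "S (g \<circ> T) \<in> carrier (dual A)" using A.dual.E.op_mem[OF Sb, of "g \<circ> T"] gT[OF g] by simp
      then show ?thesis using ev by (simp add: dual_map_def A.dual.dual_simps)
    qed
    then show ?thesis using y by auto
  qed
  \<comment> \<open>Outside the ball the value is obtained by homogeneity.\<close>
  have all: "\<exists>y\<in>carrier Y. \<forall>g. bounded_op Y scalar_space g \<longrightarrow> g y = S (g \<circ> T) x" if x: "x \<in> carrier A" for x
  proof (cases "x = 0")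
    case True
    have "S (g \<circ> T) 0 = 0" if "bounded_op Y scalar_space g" for g
      using A.D.op_0 A.dual.E.op_mem[OF Sb, of "g \<circ> T"] gT[OF that] by simp
    then show ?thesis using True by (intro bexI[of _ 0]) (auto simp: D.op_0)
  next
    case False
    obtain x1 where x1: "x1 \<in> unit_sphere A" "x = scl A (of_real (nrm A x)) x1"
      by (rule A.normalize[OF x False])
    obtain y where y: "y \<in> ?K" "\<forall>g. bounded_op Y scalar_space g \<longrightarrow> g y = S (g \<circ> T) x1"
      using ball[OF unit_sphere_subset[OF x1(1)]] by blast
    have yc: "y \<in> carrier Y" using y(1) compactin_subset_topspace[OF K] topspace by blast
    have "g (scl Y (of_real (nrm A x)) y) = S (g \<circ> T) x" if g: "bounded_op Y scalar_space g" for g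
    proof -
      have SgT: "bounded_op A scalar_space (S (g \<circ> T))"
        using A.dual.E.op_mem[OF Sb, of "g \<circ> T"] gT[OF g] by simp
      have "S (g \<circ> T) x = S (g \<circ> T) (scl A (of_real (nrm A x)) x1)" using x1(2) by simp
      also have "\<dots> = of_real (nrm A x) * S (g \<circ> T) x1"
        using A.D.op_scl[OF SgT unit_sphere_carrier[OF x1(1)]] by simp
      finally show ?thesis using y(2) g yc by (simp add: D.op_scl[OF g])
    qed
    then show ?thesis using yc by (intro bexI[of _ "scl Y (of_real (nrm A x)) y"]) auto
  qed
  have "\<forall>x\<in>carrier A. \<exists>y. y \<in> carrier Y \<and> (\<forall>g. bounded_op Y scalar_space g \<longrightarrow> g y = S (g \<circ> T) x)"
    using all by blast
  then obtain U0 where U0: "\<forall>x\<in>carrier A. U0 x \<in> carrier Y \<and>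
      (\<forall>g. bounded_op Y scalar_space g \<longrightarrow> g (U0 x) = S (g \<circ> T) x)"
    unfolding bchoice_iff ..
  define U where "U x = (if x \<in> carrier A then U0 x else 0)" for x
  have U_mem: "U x \<in> carrier Y" for x using U0 by (simp add: U_def)
  have gU: "g (U x) = S (g \<circ> T) x" if "bounded_op Y scalar_space g" "x \<in> carrier A" for g x
    using U0 that by (simp add: U_def)
  have SgT: "bounded_op A scalar_space (S (g \<circ> T))" if "bounded_op Y scalar_space g" for g
    using A.dual.E.op_mem[OF Sb, of "g \<circ> T"] gT[OF that] by simp
  have U_ball: "U x \<in> ?K" if x: "x \<in> unit_ball A" for x
  proof -
    obtain y where y: "y \<in> ?K" "\<forall>g. bounded_op Y scalar_space g \<longrightarrow> g y = S (g \<circ> T) x"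
      using ball[OF x] by blast
    have "y \<in> carrier Y" using y(1) compactin_subset_topspace[OF K] topspace by blast
    then have "U x = y"
      by (rule functionals_separate[OF U_mem]) (use gU y(2) unit_ball_carrier[OF x] in auto)
    then show ?thesis using y(1) by simp
  qed
  have "bounded_op A Y U"
  proof (rule bounded_opI[where C = "nrm (op_space A Y) T"])
    show "U x \<in> carrier Y" if "x \<in> carrier A" for x by (rule U_mem)
    show "U x = 0" if "x \<notin> carrier A" for x using that by (simp add: U_def)
    show "U (x + y) = U x + U y" if xy: "x \<in> carrier A" "y \<in> carrier A" for x y
    proof (rule functionals_separate)
      show "g (U (x + y)) = g (U x + U y)" if g: "bounded_op Y scalar_space g" for g
        using xy by (simp add: D.op_add[OF g] U_mem gU[OF g] A.D.op_add[OF SgT[OF g]])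
    qed (use U_mem in auto)
    show "U (scl A c x) = scl Y c (U x)" if x: "x \<in> carrier A" for c x
    proof (rule functionals_separate)
      show "g (U (scl A c x)) = g (scl Y c (U x))" if g: "bounded_op Y scalar_space g" for g
        using x by (simp add: D.op_scl[OF g] U_mem gU[OF g] A.D.op_scl[OF SgT[OF g]])
    qed (use U_mem in auto)
    show "nrm Y (U x) \<le> nrm (op_space A Y) T * nrm A x" if x: "x \<in> carrier A" for x
    proof (rule nrm_le_if_functionals_le[OF U_mem])
      show "0 \<le> nrm (op_space A Y) T * nrm A x" using op_nrm_nonneg[OF Tb] A.nrm_nonneg[OF x] by simp
      fix g assume g1: "g \<in> unit_sphere (dual Y)"
      then have g: "bounded_op Y scalar_space g" by (simp add: unit_sphere_def)
      have "norm (g (U x)) \<le> nrm (dual A) (S (g \<circ> T)) * nrm A x"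
        using A.dual_le[OF SgT[OF g] x] gU[OF g x] by simp
      also have "\<dots> \<le> nrm (op_space A Y) T * nrm A x"
      proof (rule mult_right_mono[OF _ A.nrm_nonneg[OF x]])
        have "nrm (dual A) (S (g \<circ> T)) \<le> nrm (dual A) (g \<circ> T)"
          using A.dual.E.op_le[OF Sb, of "g \<circ> T"] gT[OF g] S by (simp add: unit_sphere_def)
        also have "\<dots> \<le> nrm (op_space A Y) T"
          unfolding dual_def
        proof (rule A.D.op_nrm_le_onI)
          fix u assume "u \<in> unit_ball A"
          then show "nrm scalar_space ((g \<circ> T) u) \<le> nrm (op_space A Y) T"
            using dual_sphere_le[OF unit_sphere_subset[OF g1] op_mem'[OF Tb, of u]]
              op_ball_le[OF Tb, of u] by simp
        qed
        finally show "nrm (dual A) (S (g \<circ> T)) \<le> nrm (op_space A Y) T" .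
      qed
      finally show "norm (g (U x)) \<le> nrm (op_space A Y) T * nrm A x" .
    qed
  qed
  then have "ball_compact A U" by (rule ball_compactI[OF _ K]) (use U_ball in blast)
  then show ?thesis using gU by blast
qed

lemma numerical_index_ball_compact_le:
  assumes X: "normed_nspace X" "\<exists>x\<in>carrier X. x \<noteq> 0" and nz: "\<exists>y\<in>carrier Y. y \<noteq> 0"
  shows "numerical_index ((op_space X Y)\<lparr>carrier := {T. ball_compact X T}\<rparr>) \<le>
    min (numerical_index (dual X)) (numerical_index Y)"
proof -
  interpret X: space_with_dual X by (rule space_with_dual[OF X(1)])
  interpret normed_pair X Y by (intro normed_pair.intro X normed_nspace_axioms)
  have C: "bounded_op X Y T" if "T \<in> {T. ball_compact X T}" for T
    using that by (simp add: ball_compact_def)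
  note sub = ball_compact_subspace[OF X(1)]
  have rank_one: "(\<lambda>x. scl Y (f x) y) \<in> {T. ball_compact X T}"
    if f: "f \<in> unit_ball (dual X)" and y: "y \<in> carrier Y" for f y
  proof -
    have fb: "bounded_op X scalar_space f" using f by (simp add: unit_ball_def)
    have "norm (f x) \<le> 1" if "x \<in> unit_ball X" for x
      using X.dual_sphere_le[OF f, of x] that by (simp add: unit_ball_def)
    then show ?thesis using ball_compact_rank_one[OF X(1) bounded_op_rank_one[OF fb y] _ y] by simp
  qed
  obtain y0 where y0: "y0 \<in> unit_sphere Y" by (rule unit_sphere_exists[OF nz])
  obtain f0 where f0: "f0 \<in> unit_sphere (dual X)"
    by (rule X.dual.unit_sphere_exists[OF X.nonzero_dual[OF X(2)]])
  have "numerical_index ((op_space X Y)\<lparr>carrier := {T. ball_compact X T}\<rparr>) \<le> numerical_index Y"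
    by (rule numerical_index_le_codomain[OF X(1) normed_nspace_axioms nz C sub f0])
      (use rank_one[OF unit_sphere_subset[OF f0]] ball_compact_left_comp[OF X(1)] in auto)
  moreover have "numerical_index ((op_space X Y)\<lparr>carrier := {T. ball_compact X T}\<rparr>) \<le> numerical_index (dual X)"
  proof (rule numerical_index_le_dual[OF X normed_nspace_axioms y0 C sub])
    show "(\<lambda>x. scl Y (f x) y0) \<in> {T. ball_compact X T}" if "f \<in> unit_ball (dual X)" for f
      using rank_one[OF that unit_sphere_carrier[OF y0]] .
    show "\<exists>U\<in>{T. ball_compact X T}. \<forall>g x. bounded_op Y scalar_space g \<longrightarrow> x \<in> carrier X \<longrightarrow>
        g (U x) = S (g \<circ> T) x"
      if "S \<in> unit_sphere (op_space (dual X) (dual X))" "T \<in> {T. ball_compact X T}" for S T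
      using ball_compact_lift[OF X(1) that(1), of T] that(2) by auto
  qed
  ultimately show ?thesis by simp
qed

end

section \<open>The four spaces of operators\<close>

theorem theorem2p3:
  fixes X :: "('k::real_or_complex, 'v::ab_group_add) nspace"
    and Y :: "('k, 'w::ab_group_add) nspace"
  assumes "banach_space X" and "banach_space Y"
  shows "numerical_index (weak_star_op_space X Y) \<le> min (numerical_index X) (numerical_index Y) \<and>
    numerical_index (weak_star_compact_op_space X Y) \<le> min (numerical_index X) (numerical_index Y) \<and>
    numerical_index (weakly_compact_op_space X Y) \<le> min (numerical_index (dual X)) (numerical_index Y) \<and>
    numerical_index (compact_op_space X Y) \<le> min (numerical_index (dual X)) (numerical_index Y)"
proof (intro conjI)
  have X: "normed_nspace X" "\<exists>x\<in>carrier X. x \<noteq> 0" and Y: "normed_nspace Y" "\<exists>y\<in>carrier Y. y \<noteq> 0"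
    using assms by (auto intro: normed_if_banach banach_space.nonzero)
  interpret X: space_with_dual X by (rule space_with_dual[OF X(1)])
  interpret normed_pair "dual X" Y by (intro normed_pair.intro X.normed_dual Y)
  interpret N: compatible_topology Y "norm_topology Y" by (rule compatible_norm_topology[OF Y(1)])
  interpret W: compatible_topology Y "weak_topology Y" by (rule compatible_weak_topology[OF Y(1)])
  have compact: "compact_op A Y = N.ball_compact A" for A :: "('k, 'u::ab_group_add) nspace"
    by (intro ext) (simp add: compact_op_def N.ball_compact_def)
  have weakly_compact: "weakly_compact_op A Y = W.ball_compact A" for A :: "('k, 'u::ab_group_add) nspace"
    by (intro ext) (simp add: weakly_compact_op_def W.ball_compact_def)
  have right: "bounded_op (dual X) Y (T \<circ> dual_map X S)"
    if "S \<in> unit_sphere (op_space X X)" "bounded_op (dual X) Y T" for S T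
    using bounded_op_comp[OF X.normed_dual X.normed_dual Y(1) X.bounded_op_dual_map that(2)] that(1)
    by (simp add: unit_sphere_def)
  have rank_one: "bounded_op (dual X) Y (\<lambda>f. scl Y (evaluation X x f) y)"
    if "x \<in> unit_ball X" "y \<in> carrier Y" for x y
    by (rule bounded_op_rank_one[OF X.bounded_op_evaluation[OF unit_ball_carrier[OF that(1)]] that(2)])
  show "numerical_index (weak_star_op_space X Y) \<le> min (numerical_index X) (numerical_index Y)"
    unfolding weak_star_op_space_def
  proof (rule numerical_index_weak_star_continuous_le[OF X Y])
    show "bounded_op (dual X) Y (S \<circ> T)" if "bounded_op Y Y S" "bounded_op (dual X) Y T" for S T
      by (rule bounded_op_comp[OF X.normed_dual Y(1) Y(1) that(2,1)])
  qed (fact bounded_op_add bounded_op_scl right rank_one | assumption)+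
  show "numerical_index (weak_star_compact_op_space X Y) \<le> min (numerical_index X) (numerical_index Y)"
    unfolding weak_star_compact_op_space_def compact
  proof (rule numerical_index_weak_star_continuous_le[OF X Y])
    show b: "bounded_op (dual X) Y T" if "N.ball_compact (dual X) T" for T
      using that by (simp add: N.ball_compact_def)
    show "N.ball_compact (dual X) (T \<circ> dual_map X S)"
      if "S \<in> unit_sphere (op_space X X)" "N.ball_compact (dual X) T" for S T
      using N.ball_compact_right_comp[OF that(2) right[OF that(1) b[OF that(2)]]]
        X.dual_map_contraction[OF that(1)] by blast
    show "N.ball_compact (dual X) (\<lambda>f. scl Y (evaluation X x f) y)"
      if x: "x \<in> unit_ball X" and y: "y \<in> carrier Y" for x y
    proof (rule N.ball_compact_rank_one[OF X.normed_dual rank_one[OF x y] _ y])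
      fix f assume f: "f \<in> unit_ball (dual X)"
      then show "norm (evaluation X x f) \<le> 1"
        using X.dual_sphere_le[OF f unit_ball_carrier[OF x]] unit_ball_nrm[OF x]
        by (simp add: unit_ball_def)
    qed
  qed (simp_all add: N.ball_compact_add N.ball_compact_scl N.ball_compact_left_comp X.normed_dual)
  show "numerical_index (weakly_compact_op_space X Y) \<le> min (numerical_index (dual X)) (numerical_index Y)"
    unfolding weakly_compact_op_space_def weakly_compact
    by (rule W.numerical_index_ball_compact_le[OF X Y(2)])
  show "numerical_index (compact_op_space X Y) \<le> min (numerical_index (dual X)) (numerical_index Y)"
    unfolding compact_op_space_def compact
    by (rule N.numerical_index_ball_compact_le[OF X Y(2)])
qed

end
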